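(* The Markov chain $(X_n)_{n\ge 0}$ admits an absolutely continuous (with respect to $\mathfrak{m}$) stationary probability distribution $\mu$ whose density $\phi$ is Lipschitz continuous and bounded away from zero.
   Context: Let $\mathbb{S}$ be the circle obtained by identifying the endpoints of $[0,1]$, with its usual metric $d$ and Lebesgue measure $\mathfrak{m}$. Let $(\Omega,\mathcal{F},\eta)$ be a probability space and, for each $\omega_1\in\Omega$, let $T_{\omega_1}:\mathbb{S}\to\mathbb{S}$ be a $C^2$ map without critical points ($T_{\omega_1}'\neq 0$ everywhere), such that $\Omega\times\mathbb{S}\to\mathbb{S}:(\omega_1,x)\mapsto T_{\omega_1}x$ is measurable. Put $\lambda_{\omega_1}=\inf|T_{\omega_1}'|$ and $\Delta_{\omega_1}=\|T_{\omega_1}''/(T_{\omega_1}')^2\|_\infty$, and for measurable $h:\Omega\to\mathbb{R}$ write $\langle h\rangle=\int h_{\omega_1}\,d\eta(\omega_1)$. Standing assumption: $\langle\lambda^{-2}\rangle<1$ and $\langle\Delta^2\rangle<\infty$. For $\omega=(\omega_n)_{n\ge1}\in\Omega^{\mathbb{N}}$ (with the product measure $\eta^\infty$, i.e. the $\omega_n$ are drawn independently from $\eta$) and $x\in\mathbb{S}$, set $X_0(\omega,x)=x$ and $X_n(\omega,x)=T_{\omega_n}\circ\dots\circ T_{\omega_1}(x)$. This is a homogeneous Markov chain on $\mathbb{S}$ with Markov operator $\mathcal{Q}f(x)=\int_\Omega f(T_{\omega_1}x)\,d\eta(\omega_1)$ for bounded measurable $f$. A probability distribution $\mu$ on $\mathbb{S}$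 is stationary if $\int\mathcal{Q}f\,d\mu=\int f\,d\mu$ for all bounded measurable $f$. *)

theory Defs
  imports "HOL-Probability.Probability"
begin

section \<open>The circle\<close>

text \<open>The circle is \<open>[0,1]\<close> with its endpoints identified; each point is represented by its unique
  coordinate in \<open>[0,1)\<close>, and \<open>circle_of\<close> is the covering map from the real line.\<close>

typedef circle = "{0..<1::real}" morphisms coord Abs_circle
  by (rule exI[of _ 0]) simp

definition circle_of :: "real \<Rightarrow> circle" where
  "circle_of t = Abs_circle (frac t)"

lemma coord_ge_0: "0 \<le> coord x" and coord_less_1: "coord x < 1"
  using coord[of x] by auto

lemma coord_circle_of: "coord (circle_of t) = frac t"
  unfolding circle_of_def by (rule Abs_circle_inverse) (simp add: frac_lt_1)

lemma circle_of_coord: "circle_of (coord x) = x"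
proof -
  have "frac (coord x) = coord x"
    using coord_ge_0[of x] coord_less_1[of x] by (simp add: frac_eq)
  then show ?thesis by (simp add: circle_of_def coord_inverse)
qed

instantiation circle :: metric_space
begin

definition dist_circle :: "circle \<Rightarrow> circle \<Rightarrow> real" where
  "dist_circle x y = min \<bar>coord x - coord y\<bar> (1 - \<bar>coord x - coord y\<bar>)"

definition uniformity_circle :: "(circle \<times> circle) filter" where
  "uniformity_circle = (INF e\<in>{0 <..}. principal {(x, y). dist x y < e})"

definition open_circle :: "circle set \<Rightarrow> bool" where
  "open_circle U \<longleftrightarrow> (\<forall>x\<in>U. eventually (\<lambda>(x', y). x' = x \<longrightarrow> y \<in> U) uniformity)"

instance
proof
  fix x y z :: circle
  show "dist x y = 0 \<longleftrightarrow> x = y"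
    using coord_ge_0[of x] coord_less_1[of x] coord_ge_0[of y] coord_less_1[of y]
    by (auto simp: dist_circle_def min_def coord_inject[symmetric])
  show "dist x y \<le> dist x z + dist y z"
    using coord_ge_0[of x] coord_less_1[of x] coord_ge_0[of y] coord_less_1[of y]
      coord_ge_0[of z] coord_less_1[of z]
    unfolding dist_circle_def min_def by (auto split: if_splits abs_split)
qed (rule uniformity_circle_def open_circle_def)+

end

text \<open>The difference \<open>x - y\<close> modulo 1, represented in \<open>[-1/2, 1/2)\<close>.  It is a chart around \<open>y\<close>.\<close>

definition circle_diff :: "circle \<Rightarrow> circle \<Rightarrow> real" where
  "circle_diff x y = coord x - coord y - of_int (round (coord x - coord y))"

lemma circle_diff_circle_of:
  "circle_diff (circle_of s) (circle_of t) = s - t - of_int (round (s - t))"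
proof -
  have "frac s - frac t = (s - t) + of_int (\<lfloor>t\<rfloor> - \<lfloor>s\<rfloor>)"
    by (simp add: frac_def)
  moreover have "round ((s - t) + of_int (\<lfloor>t\<rfloor> - \<lfloor>s\<rfloor>)) = round (s - t) + (\<lfloor>t\<rfloor> - \<lfloor>s\<rfloor>)"
    unfolding round_def by linarith
  ultimately show ?thesis
    unfolding circle_diff_def coord_circle_of by simp
qed

lemma dist_circle_eq_circle_diff: "dist x y = \<bar>circle_diff x y\<bar>"
proof -
  define d where "d = coord x - coord y"
  have d: "-1 < d" "d < 1"
    using coord_ge_0[of x] coord_less_1[of x] coord_ge_0[of y] coord_less_1[of y]
    by (auto simp: d_def)
  consider "d < -1/2" "round d = -1" | "-1/2 \<le> d" "d < 1/2" "round d = 0" | "1/2 \<le> d" "round d = 1"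
  proof -
    have "round d = -1" if "d < -1/2" using that d unfolding round_def by linarith
    moreover have "round d = 0" if "-1/2 \<le> d" "d < 1/2" using that unfolding round_def by linarith
    moreover have "round d = 1" if "1/2 \<le> d" using that d unfolding round_def by linarith
    ultimately show ?thesis using that by linarith
  qed
  then show ?thesis
    unfolding dist_circle_def circle_diff_def d_def[symmetric]
    by cases (use d in \<open>auto simp: min_def abs_if\<close>)
qed

lemma dist_circle_of_le: "dist (circle_of s) (circle_of t) \<le> dist s t"
proof -
  have "\<bar>s - t - of_int (round (s - t))\<bar> \<le> \<bar>s - t\<bar>"
    using round_diff_minimal[of "s - t" 0] by (simp add: abs_minus_commute)
  then show ?thesis
    by (simp add: dist_circle_eq_circle_diff circle_diff_circle_of dist_real_def)
qed

lemma continuous_on_circle_of: "continuous_on UNIV circle_of"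
  unfolding continuous_on_iff by (metis dist_circle_of_le le_less_trans)

lemma measurable_circle_of [measurable]: "circle_of \<in> borel_measurable borel"
  by (rule borel_measurable_continuous_onI) (rule continuous_on_circle_of)

definition circle_lebesgue :: "circle measure" where
  "circle_lebesgue = distr (restrict_space lborel {0..1}) borel circle_of"

lemma prob_space_circle_lebesgue: "prob_space circle_lebesgue"
  unfolding circle_lebesgue_def
proof (rule prob_space.prob_space_distr)
  show "prob_space (restrict_space lborel {0..1::real})"
    by (rule prob_spaceI) (simp add: space_restrict_space emeasure_restrict_space)
  show "circle_of \<in> restrict_space lborel {0..1} \<rightarrow>\<^sub>M borel"
    by (rule measurable_restrict_space1) simp
qed


section \<open>Smooth maps of the circle\<close>

text \<open>Derivatives are taken in the charts: the first one is the derivative at \<open>0\<close> of the circle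
  displacement \<open>h \<mapsto> T (x + h) - T x\<close>, the second one that of the real function \<open>T'\<close> on the circle.\<close>

definition circle_displacement :: "(circle \<Rightarrow> circle) \<Rightarrow> circle \<Rightarrow> real \<Rightarrow> real" where
  "circle_displacement T x h = circle_diff (T (circle_of (coord x + h))) (T x)"

definition circle_deriv :: "(circle \<Rightarrow> circle) \<Rightarrow> circle \<Rightarrow> real" where
  "circle_deriv T x = deriv (circle_displacement T x) 0"

definition circle_deriv2 :: "(circle \<Rightarrow> circle) \<Rightarrow> circle \<Rightarrow> real" where
  "circle_deriv2 T x = deriv (\<lambda>t. circle_deriv T (circle_of t)) (coord x)"

definition C2_circle_map :: "(circle \<Rightarrow> circle) \<Rightarrow> bool" where
  "C2_circle_map T \<longleftrightarrow>
     (\<forall>x. circle_displacement T x field_differentiable at 0) \<and>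
     (\<forall>x. (\<lambda>t. circle_deriv T (circle_of t)) field_differentiable at (coord x)) \<and>
     continuous_on UNIV (circle_deriv2 T)"

lemma circle_displacement_lift:
  assumes lift: "\<And>t. T (circle_of t) = circle_of (F t)"
    and F: "(F has_real_derivative D) (at t)"
  shows "(circle_displacement T (circle_of t) has_real_derivative D) (at 0)"
proof -
  define G where "G = (\<lambda>h. F (h + t) - F t)"
  have shift: "circle_of (frac t + h) = circle_of (h + t)" for h
  proof -
    have "frac (frac t + h) = frac (h + t)"
      by (metis add.commute frac_add_simps(1))
    then show ?thesis by (simp add: circle_of_def)
  qed
  have disp: "circle_displacement T (circle_of t) h = G h - of_int (round (G h))" for h
    unfolding circle_displacement_def coord_circle_of shift lift circle_diff_circle_of G_def ..
  have "((\<lambda>h. F (h + t)) has_real_derivative D) (at 0)"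
    using F DERIV_shift[of F D 0 t] by simp
  then have G: "(G has_real_derivative D) (at 0)"
    unfolding G_def by (auto intro!: derivative_eq_intros)
  then have "isCont G 0"
    by (rule DERIV_isCont)
  then have "(G \<longlongrightarrow> G 0) (nhds 0)"
    unfolding isCont_def tendsto_at_iff_tendsto_nhds .
  then have "(G \<longlongrightarrow> 0) (nhds 0)"
    by (simp add: G_def)
  then have "\<forall>\<^sub>F h in nhds 0. dist (G h) 0 < 1/2"
    by (rule tendstoD) simp
  then have "\<forall>\<^sub>F h in nhds 0. circle_displacement T (circle_of t) h = G h"
  proof eventually_elim
    case (elim h)
    then have "round (G h) = 0"
      unfolding round_def dist_real_def by linarith
    then show ?case by (simp add: disp)
  qed
  then show ?thesis
    using G DERIV_cong_ev[OF refl _ refl] by blast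
qed

corollary circle_deriv_lift:
  assumes "\<And>t. T (circle_of t) = circle_of (F t)" "(F has_real_derivative D) (at t)"
  shows "circle_deriv T (circle_of t) = D"
  unfolding circle_deriv_def by (rule DERIV_imp_deriv) (rule circle_displacement_lift[OF assms])

text \<open>For a \<open>C\<^sup>2\<close> map without critical points both extrema below range over a bounded set, as the
  circle is compact, so the conventions for unbounded real sets play no role.  By continuity the
  supremum coincides with the essential supremum with respect to Lebesgue measure.\<close>

definition min_expansion :: "(circle \<Rightarrow> circle) \<Rightarrow> real" where
  "min_expansion T = (INF x. \<bar>circle_deriv T x\<bar>)"

definition distortion :: "(circle \<Rightarrow> circle) \<Rightarrow> real" where
  "distortion T = (SUP x. \<bar>circle_deriv2 T x / (circle_deriv T x)\<^sup>2\<bar>)"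


section \<open>The Markov chain\<close>

text \<open>The driving sequence is indexed from \<open>0\<close>, so \<open>\<omega> n\<close> is the map index usually
  called \<open>\<omega>\<close> with subscript \<open>n + 1\<close>.\<close>

primrec chain :: "('w \<Rightarrow> circle \<Rightarrow> circle) \<Rightarrow> nat \<Rightarrow> (nat \<Rightarrow> 'w) \<Rightarrow> circle \<Rightarrow> circle" where
  "chain T 0 \<omega> x = x"
| "chain T (Suc n) \<omega> x = T (\<omega> n) (chain T n \<omega> x)"

definition markov_op ::
  "'w measure \<Rightarrow> ('w \<Rightarrow> circle \<Rightarrow> circle) \<Rightarrow> (circle \<Rightarrow> real) \<Rightarrow> circle \<Rightarrow> real" where
  "markov_op \<eta> T f x = (\<integral>w. f (T w x) \<partial>\<eta>)"

definition stationary ::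
  "'w measure \<Rightarrow> ('w \<Rightarrow> circle \<Rightarrow> circle) \<Rightarrow> circle measure \<Rightarrow> bool" where
  "stationary \<eta> T \<mu> \<longleftrightarrow> sets \<mu> = sets borel \<and> prob_space \<mu> \<and>
     (\<forall>f\<in>borel_measurable borel. bounded (range f) \<longrightarrow>
        (\<integral>x. markov_op \<eta> T f x \<partial>\<mu>) = (\<integral>x. f x \<partial>\<mu>))"

lemma chain_case_nat: "chain T (Suc n) (case_nat w \<omega>) x = chain T n \<omega> (T w x)"
  by (induction n) simp_all

text \<open>The iterates of the Markov operator give the expectations along the chain.\<close>

lemma expectation_chain:
  fixes f :: "circle \<Rightarrow> real"
  assumes \<eta>: "prob_space \<eta>"
    and T: "(\<lambda>(w, x). T w x) \<in> \<eta> \<Otimes>\<^sub>M borel \<rightarrow>\<^sub>M borel"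
    and f: "f \<in> borel_measurable borel" "bounded (range f)"
  shows "(\<integral>\<omega>. f (chain T n \<omega> x) \<partial>(\<Pi>\<^sub>M i\<in>UNIV. \<eta>)) = (markov_op \<eta> T ^^ n) f x"
proof -
  interpret prob_space \<eta> by fact
  interpret sequence_space \<eta> ..
  interpret P: pair_prob_space \<eta> "\<Pi>\<^sub>M i\<in>(UNIV::nat set). \<eta>" ..
  obtain B where B: "\<And>x. \<bar>f x\<bar> \<le> B"
    using f(2) unfolding bounded_iff by auto
  have T': "(\<lambda>u. T (g u) (h u)) \<in> N \<rightarrow>\<^sub>M borel"
    if "g \<in> N \<rightarrow>\<^sub>M \<eta>" "h \<in> N \<rightarrow>\<^sub>M borel" for g h and N :: "'z measure"
    using measurable_compose[OF measurable_Pair[OF that] T] by simp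
  have chain_meas: "(\<lambda>\<omega>. chain T n \<omega> x) \<in> (\<Pi>\<^sub>M i\<in>UNIV. \<eta>) \<rightarrow>\<^sub>M borel" for n x
    by (induction n) (auto intro!: T' measurable_component_singleton)
  show ?thesis
  proof (induction n arbitrary: x)
    case 0
    then show ?case using prob_space.prob_space[OF prob_space_PiM[of "UNIV :: nat set" "\<lambda>_. \<eta>"]] \<eta> by simp
  next
    case (Suc n)
    have fc: "(\<lambda>\<omega>. f (chain T (Suc n) \<omega> x)) \<in> borel_measurable (\<Pi>\<^sub>M i\<in>UNIV. \<eta>)"
      by (rule measurable_compose[OF chain_meas f(1)])
    have cn: "(\<lambda>(w, \<omega>). case_nat w \<omega>) \<in> \<eta> \<Otimes>\<^sub>M (\<Pi>\<^sub>M i\<in>UNIV. \<eta>) \<rightarrow>\<^sub>M (\<Pi>\<^sub>M i\<in>(UNIV::nat set). \<eta>)"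
      by measurable
    have "(\<integral>\<omega>. f (chain T (Suc n) \<omega> x) \<partial>(\<Pi>\<^sub>M i\<in>UNIV. \<eta>))
        = (\<integral>\<omega>. f (chain T (Suc n) \<omega> x)
            \<partial>distr (\<eta> \<Otimes>\<^sub>M (\<Pi>\<^sub>M i\<in>UNIV. \<eta>)) (\<Pi>\<^sub>M i\<in>UNIV. \<eta>) (\<lambda>(w, \<omega>). case_nat w \<omega>))"
      by (simp only: PiM_iter)
    also have "\<dots> = (\<integral>u. f (chain T (Suc n) (case u of (w, \<omega>) \<Rightarrow> case_nat w \<omega>) x)
        \<partial>(\<eta> \<Otimes>\<^sub>M (\<Pi>\<^sub>M i\<in>UNIV. \<eta>)))"
      by (rule integral_distr[OF cn fc])
    also have "\<dots> = (\<integral>w. \<integral>\<omega>. f (chain T (Suc n) (case_nat w \<omega>) x) \<partial>(\<Pi>\<^sub>M i\<in>UNIV. \<eta>) \<partial>\<eta>)"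
    proof (subst P.integral_fst'[symmetric])
      show "integrable (\<eta> \<Otimes>\<^sub>M (\<Pi>\<^sub>M i\<in>UNIV. \<eta>))
          (\<lambda>u. f (chain T (Suc n) (case u of (w, \<omega>) \<Rightarrow> case_nat w \<omega>) x))"
        by (rule P.integrable_const_bound[of _ B])
          (use B measurable_compose[OF cn fc] in \<open>auto simp del: chain.simps\<close>)
    qed simp
    also have "\<dots> = (\<integral>w. (markov_op \<eta> T ^^ n) f (T w x) \<partial>\<eta>)"
      by (simp only: chain_case_nat Suc.IH)
    also have "\<dots> = (markov_op \<eta> T ^^ Suc n) f x"
      by (simp add: markov_op_def[of \<eta> T "(markov_op \<eta> T ^^ n) f"])
    finally show ?case .
  qed
qed

end

theory Submission
  imports Defs "HOL-Complex_Analysis.Great_Picard"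
begin

text \<open>
  The distributions of the chain started from Lebesgue measure have densities that are Lipschitz with a
  uniform constant.  A uniform limit of time averages of these densities is the
  density of a stationary distribution, and expansion makes it positive everywhere.

  \<^bold>\<open>Regularity.\<close>  Call a density \<open>h\<close> regular with constant \<open>a\<close> if \<open>\<bar>h'\<bar> \<le> a h\<close>.  A map with minimal
  expansion \<open>\<lambda>\<close> and distortion \<open>\<Delta>\<close> carries constant \<open>a\<close> to constant \<open>a / \<lambda> + \<Delta>\<close>
  (\<open>log_lipschitz_image\<close>).  For independent maps this is a random affine recursion, and its second moment
  stays bounded because \<open>\<langle>\<lambda>\<^sup>-\<^sup>2\<rangle> < 1\<close> and \<open>\<langle>\<Delta>\<^sup>2\<rangle> < \<infinity>\<close> (\<open>log_lipschitz_constant_drift\<close>).  A regular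
  probability density is at most \<open>1 + a\<close>, hence has Lipschitz constant at most \<open>a (1 + a)\<close>; the expectation of this is
  the uniform Lipschitz constant of the averaged densities (\<open>markov_op_power_deriv_bound\<close>).

  All of this is expressed by duality with \<open>C\<^sup>1\<close> test functions: \<open>\<bar>h'\<bar> \<le> a h\<close> becomes
  \<open>\<bar>\<integral> g' d\<nu>\<bar> \<le> a \<integral> \<bar>g\<bar> d\<nu>\<close>, and the Lipschitz bound becomes \<open>\<bar>\<integral> g' d\<nu>\<bar> \<le> K \<integral> \<bar>g\<bar> dm\<close>, where
  \<open>m\<close> is Lebesgue measure.  In this form a map acts by composition with test functions, which replaces sums over inverse
  branches, and averaging over the random maps is Fubini's theorem.

  \<^bold>\<open>Existence.\<close>  Mollification turns the second inequality into a genuine Lipschitz bound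
  (\<open>mollify_lipschitz\<close>).  The theorem of Arzela and Ascoli, applied to mollified time averages, gives the stationary Lipschitz density
  (\<open>exists_stationary_lipschitz_density\<close>).

  \<^bold>\<open>Positivity.\<close>  Since \<open>\<langle>\<lambda>\<^sup>-\<^sup>2\<rangle> < 1\<close>, with positive probability \<open>\<lambda>\<close> exceeds some constant greater than \<open>1\<close>.  With positive
  probability, finitely many steps therefore stretch an arc on which the density is positive over
  the whole circle, and stationarity spreads the positivity everywhere
  (\<open>stationary_density_bounded_below\<close>).
\<close>

section \<open>Topology and calculus on the circle\<close>

lemma circle_of_add_int: "circle_of (t + of_int k) = circle_of t"
  by (simp add: circle_of_def frac_def)

lemma circle_of_add_1: "circle_of (t + 1) = circle_of t"
  using circle_of_add_int[of t 1] by simp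

lemma circle_of_add_circle_diff: "circle_of (coord x + circle_diff y x) = y"
proof -
  have "coord x + circle_diff y x = coord y + of_int (- round (coord y - coord x))"
    by (simp add: circle_diff_def)
  then show ?thesis by (metis circle_of_add_int circle_of_coord)
qed

lemma circle_of_coord_add: "circle_of (coord (circle_of t) + h) = circle_of (t + h)"
proof -
  have "coord (circle_of t) + h = (t + h) + of_int (- \<lfloor>t\<rfloor>)"
    by (simp add: coord_circle_of frac_def)
  then show ?thesis by (metis circle_of_add_int)
qed

lemma tendsto_circle_diff: "((\<lambda>y. circle_diff y x) \<longlongrightarrow> 0) (at x)"
  by (rule tendstoI) (auto simp: eventually_at dist_circle_eq_circle_diff[symmetric] intro: exI)

lemma circle_eq_image: "(UNIV :: circle set) = circle_of ` {0..1}"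
proof -
  have "x \<in> circle_of ` {0..1}" for x
    using coord_ge_0[of x] coord_less_1[of x] circle_of_coord[of x]
    by (intro image_eqI[of _ _ "coord x"]) auto
  then show ?thesis by auto
qed

lemma compact_circle: "compact (UNIV :: circle set)"
  unfolding circle_eq_image
  by (rule compact_continuous_image) (auto intro: continuous_on_subset[OF continuous_on_circle_of])

lemma connected_circle: "connected (UNIV :: circle set)"
  unfolding circle_eq_image
  by (rule connected_continuous_image) (auto intro: continuous_on_subset[OF continuous_on_circle_of])

lemma bounded_continuous_circle:
  fixes f :: "circle \<Rightarrow> real"
  assumes "continuous_on UNIV f"
  obtains B where "0 < B" "\<And>x. \<bar>f x\<bar> \<le> B"
proof -
  have "bounded (range f)"
    using compact_continuous_image[OF assms compact_circle] by (rule compact_imp_bounded)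
  then show ?thesis using that unfolding bounded_pos by auto
qed

text \<open>The chart \<open>y \<mapsto> circle_diff y x\<close> inverts the covering map near \<open>x\<close>, so continuity descends from the
  line to the circle.\<close>

lemma continuous_circleI:
  fixes f :: "circle \<Rightarrow> 'b::topological_space"
  assumes "continuous_on UNIV (\<lambda>t. f (circle_of t))"
  shows "continuous_on UNIV f"
proof -
  have "(f \<longlongrightarrow> f x) (at x)" for x
  proof -
    have "isCont (\<lambda>t. f (circle_of t)) (coord x + 0)"
      using assms by (simp add: continuous_on_eq_continuous_at)
    then have "((\<lambda>y. f (circle_of (coord x + circle_diff y x))) \<longlongrightarrow> f (circle_of (coord x + 0))) (at x)"
      by (rule isCont_tendsto_compose) (intro tendsto_intros tendsto_circle_diff)
    then show ?thesis
      by (simp add: circle_of_add_circle_diff circle_of_coord)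
  qed
  then show ?thesis by (simp add: continuous_on_def)
qed

text \<open>The coordinate jumps at the base point, but its sublevel sets are images of compact intervals
  under the covering map, hence closed.\<close>

lemma borel_measurable_coord [measurable]: "coord \<in> borel_measurable borel"
proof (rule borel_measurable_iff_le[THEN iffD2, rule_format])
  fix a :: real
  show "{x \<in> space borel. coord x \<le> a} \<in> sets borel"
  proof (cases "a < 1")
    case True
    have "{x. coord x \<le> a} = circle_of ` {0..a}"
    proof (intro equalityI subsetI)
      fix x assume "x \<in> {x. coord x \<le> a}"
      then show "x \<in> circle_of ` {0..a}"
        using coord_ge_0[of x] circle_of_coord[of x]
        by (intro image_eqI[of _ _ "coord x"]) auto
    next
      fix x assume "x \<in> circle_of ` {0..a}"
      then obtain t where "0 \<le> t" "t \<le> a" "x = circle_of t" by auto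
      then show "x \<in> {x. coord x \<le> a}"
        using True by (simp add: coord_circle_of frac_eq[THEN iffD2])
    qed
    moreover have "compact (circle_of ` {0..a})"
      by (rule compact_continuous_image) (auto intro: continuous_on_subset[OF continuous_on_circle_of])
    ultimately show ?thesis
      by (simp add: compact_imp_closed)
  next
    case False
    then have "coord x \<le> a" for x
      using coord_less_1[of x] by linarith
    then have "{x \<in> space borel. coord x \<le> a} = UNIV"
      by simp
    then show ?thesis by simp
  qed
qed

text \<open>The \<open>C\<^sup>1\<close> functions serve as test functions throughout: the regularity of a measure and the velocity of a path
  are expressed by their action on them.  The derivative is that of the \<open>1\<close>-periodic lift to the
  line, but it is recorded as a function on the circle, so that it can itself be integrated against a
  measure on the circle.\<close>

definition circle_C1 :: "(circle \<Rightarrow> real) \<Rightarrow> (circle \<Rightarrow> real) \<Rightarrow> bool" where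
  "circle_C1 g g' \<longleftrightarrow>
     (\<forall>t. ((\<lambda>s. g (circle_of s)) has_real_derivative g' (circle_of t)) (at t)) \<and>
     continuous_on UNIV g'"

lemma circle_C1_D:
  assumes "circle_C1 g g'"
  shows "((\<lambda>s. g (circle_of s)) has_real_derivative g' (circle_of t)) (at t)"
    and "continuous_on UNIV g'"
  using assms by (auto simp: circle_C1_def)

lemma circle_C1_continuous:
  assumes "circle_C1 g g'"
  shows "continuous_on UNIV g"
  by (rule continuous_circleI)
     (auto simp: continuous_on_eq_continuous_at intro: DERIV_isCont circle_C1_D[OF assms])

lemma circle_C1_mult:
  assumes f: "circle_C1 f f'" and g: "circle_C1 g g'"
  shows "circle_C1 (\<lambda>x. f x * g x) (\<lambda>x. f' x * g x + g' x * f x)"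
  unfolding circle_C1_def
  by (auto intro!: derivative_eq_intros continuous_intros circle_C1_D[OF f] circle_C1_D[OF g]
      circle_C1_continuous[OF f] circle_C1_continuous[OF g])

lemma circle_C1_inverse:
  assumes f: "circle_C1 f f'" and nz: "\<And>x. f x \<noteq> 0"
  shows "circle_C1 (\<lambda>x. inverse (f x)) (\<lambda>x. - (f' x / (f x)\<^sup>2))"
  unfolding circle_C1_def
  by (auto intro!: derivative_eq_intros continuous_intros circle_C1_D[OF f]
      circle_C1_continuous[OF f] simp: nz power2_eq_square field_simps)

lemma C2_circle_map_continuous:
  assumes "C2_circle_map T"
  shows "continuous_on UNIV T"
proof -
  have "(T \<longlongrightarrow> T x) (at x)" for x
  proof -
    have d0: "circle_diff y y = 0" for y by (simp add: circle_diff_def)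
    have "isCont (circle_displacement T x) 0"
      using assms by (auto simp: C2_circle_map_def intro: field_differentiable_imp_continuous_at)
    then have "((\<lambda>y. circle_displacement T x (circle_diff y x)) \<longlongrightarrow> circle_displacement T x 0) (at x)"
      using tendsto_circle_diff by (rule isCont_tendsto_compose)
    then have "((\<lambda>y. circle_diff (T y) (T x)) \<longlongrightarrow> 0) (at x)"
      by (simp add: circle_displacement_def circle_of_add_circle_diff circle_of_coord d0)
    then show ?thesis
      by (auto simp: tendsto_iff dist_circle_eq_circle_diff)
  qed
  then show ?thesis by (simp add: continuous_on_def)
qed

lemma C2_circle_map_deriv_C1:
  assumes "C2_circle_map T"
  shows "circle_C1 (circle_deriv T) (circle_deriv2 T)"
  unfolding circle_C1_def
proof (intro conjI allI)
  show "continuous_on UNIV (circle_deriv2 T)"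
    using assms by (simp add: C2_circle_map_def)
  fix t :: real
  let ?x = "circle_of t" and ?f = "\<lambda>s. circle_deriv T (circle_of s)"
  have "(?f has_real_derivative circle_deriv2 T ?x) (at (coord ?x))"
    using assms field_differentiable_derivI unfolding C2_circle_map_def circle_deriv2_def by blast
  then have "(?f has_real_derivative circle_deriv2 T ?x) (at (t + (coord ?x - t)))"
    by simp
  then have "((\<lambda>s. ?f (s + (coord ?x - t))) has_real_derivative circle_deriv2 T ?x) (at t)"
    by (simp only: DERIV_shift)
  moreover have "circle_of (s + (coord ?x - t)) = circle_of s" for s
    using circle_of_coord_add[of t "s - t"] by (simp add: algebra_simps)
  ultimately show "(?f has_real_derivative circle_deriv2 T ?x) (at t)"
    by simp
qed

text \<open>Near \<open>x\<close> the lift of \<open>g \<circ> T\<close> is the lift of \<open>g\<close>, shifted to the coordinate of \<open>T x\<close>, after the displacement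
  of \<open>T\<close> at \<open>x\<close>.  The chain rule on the line therefore applies, without a global lift of \<open>T\<close>.\<close>

lemma circle_C1_compose:
  assumes T: "C2_circle_map T" and g: "circle_C1 g g'"
  shows "circle_C1 (\<lambda>x. g (T x)) (\<lambda>x. g' (T x) * circle_deriv T x)"
  unfolding circle_C1_def
proof (intro conjI allI)
  have "continuous_on UNIV (\<lambda>x. g' (T x))"
    using continuous_on_compose2[OF circle_C1_D(2)[OF g] C2_circle_map_continuous[OF T]] by simp
  then show "continuous_on UNIV (\<lambda>x. g' (T x) * circle_deriv T x)"
    by (intro continuous_intros circle_C1_continuous[OF C2_circle_map_deriv_C1[OF T]])
  fix t :: real
  let ?x = "circle_of t"
  have d0: "circle_displacement T ?x 0 = 0"
    by (simp add: circle_displacement_def circle_of_coord circle_diff_def)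
  have 1: "(circle_displacement T ?x has_real_derivative circle_deriv T ?x) (at 0)"
    using T field_differentiable_derivI unfolding C2_circle_map_def circle_deriv_def by blast
  have 2: "((\<lambda>h. g (circle_of (coord (T ?x) + h))) has_real_derivative g' (T ?x))
    (at (circle_displacement T ?x 0))"
    using circle_C1_D(1)[OF g, of "coord (T ?x)"] DERIV_shift[of "\<lambda>s. g (circle_of s)" _ 0 "coord (T ?x)"]
    by (simp add: d0 circle_of_coord add.commute)
  have "((\<lambda>h. g (circle_of (coord (T ?x) + circle_displacement T ?x h)))
    has_real_derivative g' (T ?x) * circle_deriv T ?x) (at 0)"
    using DERIV_chain2[OF 2 1] .
  then have "((\<lambda>h. g (T (circle_of (h + t)))) has_real_derivative g' (T ?x) * circle_deriv T ?x) (at 0)"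
    by (simp add: circle_displacement_def circle_of_add_circle_diff circle_of_coord_add add.commute[of _ t])
  then show "((\<lambda>s. g (T (circle_of s))) has_real_derivative g' (T ?x) * circle_deriv T ?x) (at t)"
    using DERIV_shift[of "\<lambda>s. g (T (circle_of s))" _ 0 t] by simp
qed

section \<open>Integration on intervals and on the circle\<close>

abbreviation lborel_on :: "real \<Rightarrow> real \<Rightarrow> real measure" where
  "lborel_on a b \<equiv> restrict_space lborel {a..b}"

lemma finite_measure_interval: "finite_measure (lborel_on a b)"
  by (rule finite_measureI)
     (use emeasure_compact_finite[of "{a..b}"] in \<open>simp add: space_restrict_space emeasure_restrict_space\<close>)

lemma integral_interval_FTC:
  fixes F :: "real \<Rightarrow> real"
  assumes "a \<le> b" "\<And>t. (F has_real_derivative f t) (at t)" "continuous_on UNIV f"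
  shows "(\<integral>t. f t \<partial>lborel_on a b) = F b - F a"
proof -
  have "integral\<^sup>L lborel (\<lambda>x. indicator {a .. b} x *\<^sub>R f x) = F b - F a"
    using assms
    by (intro integral_FTC_atLeastAtMost)
       (auto intro: continuous_on_subset has_field_derivative_at_within
          simp: has_real_derivative_iff_has_vector_derivative[symmetric])
  then show ?thesis by (simp add: integral_restrict_space)
qed

lemma measure_interval: "a \<le> b \<Longrightarrow> measure (lborel_on a b) (space (lborel_on a b)) = b - a"
  by (simp add: space_restrict_space measure_restrict_space)

lemma measurable_interval [measurable (raw)]:
  "f \<in> borel_measurable borel \<Longrightarrow> f \<in> borel_measurable (lborel_on a b)"
  by (rule measurable_restrict_space1) simp

lemma integrable_continuous_interval:
  fixes f :: "real \<Rightarrow> real"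
  assumes "continuous_on UNIV f"
  shows "integrable (lborel_on a b) f"
proof -
  have "compact (f ` {a..b})"
    by (rule compact_continuous_image) (auto intro: continuous_on_subset[OF assms])
  then have "bounded (f ` {a..b})" by (rule compact_imp_bounded)
  then obtain B where B: "\<And>t. t \<in> {a..b} \<Longrightarrow> \<bar>f t\<bar> \<le> B"
    unfolding bounded_iff by (metis imageI real_norm_def)
  have "f \<in> borel_measurable borel" using assms by (rule borel_measurable_continuous_onI)
  then show ?thesis
    by (intro finite_measure.integrable_const_bound[OF finite_measure_interval, of _ B])
      (use B in \<open>auto simp: space_restrict_space intro!: AE_I2\<close>)
qed

lemma sets_circle_lebesgue [simp, measurable_cong]: "sets circle_lebesgue = sets borel"
  by (simp add: circle_lebesgue_def)

lemma space_circle_lebesgue [simp]: "space circle_lebesgue = UNIV"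
  by (simp add: circle_lebesgue_def)

lemma integral_circle_lebesgue:
  fixes f :: "circle \<Rightarrow> real"
  assumes "f \<in> borel_measurable borel"
  shows "(\<integral>x. f x \<partial>circle_lebesgue) = (\<integral>t. f (circle_of t) \<partial>lborel_on 0 1)"
  unfolding circle_lebesgue_def by (rule integral_distr) (use assms in auto)

lemma integrable_bounded_borel:
  fixes f :: "circle \<Rightarrow> real"
  assumes "prob_space \<nu>" "sets \<nu> = sets borel" "f \<in> borel_measurable borel" "\<And>x. \<bar>f x\<bar> \<le> B"
  shows "integrable \<nu> f"
proof -
  interpret prob_space \<nu> by fact
  show ?thesis
    by (rule integrable_const_bound[of _ B])
       (use assms in \<open>auto simp: measurable_cong_sets[OF assms(2) refl]\<close>)
qed

lemma integrable_continuous_circle: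
  fixes f :: "circle \<Rightarrow> real"
  assumes "prob_space \<nu>" "sets \<nu> = sets borel" "continuous_on UNIV f"
  shows "integrable \<nu> f"
proof -
  obtain B where "\<And>x. \<bar>f x\<bar> \<le> B" using bounded_continuous_circle[OF assms(3)] by metis
  with assms show ?thesis
    by (intro integrable_bounded_borel borel_measurable_continuous_onI)
qed

lemma integral_circle_C1_deriv:
  assumes "circle_C1 g g'"
  shows "(\<integral>x. g' x \<partial>circle_lebesgue) = 0"
proof -
  have c: "continuous_on UNIV g'" by (rule circle_C1_D[OF assms])
  have "(\<integral>x. g' x \<partial>circle_lebesgue) = (\<integral>t. g' (circle_of t) \<partial>lborel_on 0 1)"
    by (rule integral_circle_lebesgue) (rule borel_measurable_continuous_onI[OF c])
  also have "\<dots> = g (circle_of 1) - g (circle_of 0)"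
    by (rule integral_interval_FTC)
       (auto intro: circle_C1_D[OF assms] continuous_on_compose2[OF c continuous_on_circle_of])
  also have "\<dots> = 0"
    using circle_of_add_1[of 0] by simp
  finally show ?thesis .
qed

text \<open>An antiderivative of a function on the circle lives on the line; it grows by the mean of the function
  over each period.\<close>

lemma antiderivative_circle_lift:
  fixes u :: "circle \<Rightarrow> real"
  assumes u: "continuous_on UNIV u"
  obtains F where "\<And>t. (F has_real_derivative u (circle_of t)) (at t)"
    "\<And>t. F (t + 1) = F t + (\<integral>x. u x \<partial>circle_lebesgue)"
proof -
  have cu: "continuous_on UNIV (\<lambda>t. u (circle_of t))"
    using continuous_on_compose2[OF u continuous_on_circle_of] by simp
  obtain F where F0: "\<And>t. (F has_vector_derivative u (circle_of t)) (at t)"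
    using einterval_antiderivative[of "-\<infinity>" "\<infinity>" "\<lambda>t. u (circle_of t)"] cu
    by (auto simp: continuous_on_eq_continuous_at)
  then have F: "(F has_real_derivative u (circle_of t)) (at t)" for t
    by (simp add: has_real_derivative_iff_has_vector_derivative)
  have "((\<lambda>t. F (t + 1) - F t) has_real_derivative 0) (at t)" for t
    using F[of "t + 1"] F[of t] DERIV_shift[of F _ t 1]
    by (auto intro!: derivative_eq_intros simp: circle_of_add_1)
  then have "F (t + 1) - F t = F (0 + 1) - F 0" for t
    using DERIV_isconst_all[of "\<lambda>t. F (t + 1) - F t" t 0] by blast
  moreover have "(\<integral>x. u x \<partial>circle_lebesgue) = F 1 - F 0"
    using integral_circle_lebesgue[OF borel_measurable_continuous_onI[OF u]]
      integral_interval_FTC[of 0 1 F, OF _ F cu] by simp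
  ultimately have "F (t + 1) = F t + (\<integral>x. u x \<partial>circle_lebesgue)" for t
    by (metis add_0 add.commute diff_add_cancel)
  with F that show ?thesis by blast
qed

lemma periodic_add_int:
  fixes G :: "real \<Rightarrow> 'a"
  assumes "\<And>t. G (t + 1) = G t"
  shows "G (t + of_int k) = G t"
proof -
  have nat: "G (s + real n) = G s" for s n
    by (induction n) (auto simp: assms add.assoc[symmetric] add.commute[of 1])
  show ?thesis
  proof (cases "k \<ge> 0")
    case True
    then show ?thesis using nat[of t "nat k"] by simp
  next
    case False
    then show ?thesis using nat[of "t + of_int k" "nat (- k)"] by simp
  qed
qed

lemma periodic_coord:
  assumes "\<And>t. G (t + 1) = G t"
  shows "G (coord (circle_of t)) = G t"
  using periodic_add_int[of G "t" "- \<lfloor>t\<rfloor>", OF assms] by (simp add: coord_circle_of frac_def)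

lemma circle_C1_of_periodic:
  assumes "\<And>t. G (t + 1) = G t" "\<And>t. (G has_real_derivative g' (circle_of t)) (at t)"
    "continuous_on UNIV g'"
  shows "circle_C1 (\<lambda>x. G (coord x)) g'"
  using assms by (simp add: circle_C1_def periodic_coord[of G, OF assms(1)])

text \<open>Subtracting its mean from \<open>u\<close> makes the antiderivative periodic.  When \<open>u\<close> is nonnegative with mean
  \<open>m\<close>, both the antiderivative of \<open>u\<close> and the linear function removed from it increase from \<open>0\<close> to \<open>m\<close>
  over one period, which bounds their difference by \<open>m\<close>.  This elementary bound turns information about derivatives of
  test functions into information about nonnegative functions; it yields both the upper bound on
  densities and the covering estimate for fast paths below.\<close>

lemma circle_C1_antiderivative:
  fixes u :: "circle \<Rightarrow> real"
  assumes u: "continuous_on UNIV u" and nonneg: "\<And>x. 0 \<le> u x"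
  obtains g where "circle_C1 g (\<lambda>x. u x - (\<integral>x. u x \<partial>circle_lebesgue))"
    "\<And>x. \<bar>g x\<bar> \<le> (\<integral>x. u x \<partial>circle_lebesgue)"
proof -
  define m where "m = (\<integral>x. u x \<partial>circle_lebesgue)"
  obtain F where F: "\<And>t. (F has_real_derivative u (circle_of t)) (at t)"
    "\<And>t. F (t + 1) = F t + m"
    using antiderivative_circle_lift[OF u] unfolding m_def by blast
  define G where "G t = F t - F 0 - m * t" for t
  have "circle_C1 (\<lambda>x. G (coord x)) (\<lambda>x. u x - m)"
    by (rule circle_C1_of_periodic)
       (auto simp: G_def F(2) algebra_simps intro!: derivative_eq_intros F(1) continuous_intros u)
  moreover have "\<bar>G (coord x)\<bar> \<le> m" for x
  proof -
    have mono: "F s \<le> F t" if "s \<le> t" for s t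
      by (rule DERIV_nonneg_imp_nondecreasing[OF that]) (use F(1) nonneg in blast)
    have t: "0 \<le> coord x" "coord x \<le> 1" using coord_ge_0[of x] coord_less_1[of x] by auto
    have "F 1 = F 0 + m" using F(2)[of 0] by simp
    with mono[OF t(1)] mono[OF t(2)] have b: "0 \<le> F (coord x) - F 0" "F (coord x) - F 0 \<le> m" by auto
    moreover from this have "0 \<le> m" by linarith
    with t have "0 \<le> m * coord x" "m * coord x \<le> m" by (auto simp: mult_left_le)
    ultimately show ?thesis unfolding G_def by linarith
  qed
  ultimately show ?thesis using that unfolding m_def by blast
qed



section \<open>Expansion and distortion\<close>

lemma min_expansion_le: "min_expansion T \<le> \<bar>circle_deriv T x\<bar>"
  unfolding min_expansion_def by (rule cINF_lower) (auto intro!: bdd_belowI[of _ 0])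

lemma min_expansion_pos:
  assumes T: "C2_circle_map T" and nz: "\<And>x. circle_deriv T x \<noteq> 0"
  shows "0 < min_expansion T"
proof -
  have "continuous_on UNIV (\<lambda>x. \<bar>circle_deriv T x\<bar>)"
    by (intro continuous_intros circle_C1_continuous[OF C2_circle_map_deriv_C1[OF T]])
  then obtain y where "\<And>x. \<bar>circle_deriv T y\<bar> \<le> \<bar>circle_deriv T x\<bar>"
    using continuous_attains_inf[OF compact_circle, of "\<lambda>x. \<bar>circle_deriv T x\<bar>"] by auto
  then have "\<bar>circle_deriv T y\<bar> \<le> min_expansion T"
    unfolding min_expansion_def by (intro cINF_greatest) auto
  moreover have "0 < \<bar>circle_deriv T y\<bar>" using nz by simp
  ultimately show ?thesis by linarith
qed

lemma continuous_distortion: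
  assumes T: "C2_circle_map T" and nz: "\<And>x. circle_deriv T x \<noteq> 0"
  shows "continuous_on UNIV (\<lambda>x. circle_deriv2 T x / (circle_deriv T x)\<^sup>2)"
  using circle_C1_D(2)[OF C2_circle_map_deriv_C1[OF T]]
    circle_C1_continuous[OF C2_circle_map_deriv_C1[OF T]] nz
  by (auto intro!: continuous_intros)

lemma le_distortion:
  assumes T: "C2_circle_map T" and nz: "\<And>x. circle_deriv T x \<noteq> 0"
  shows "\<bar>circle_deriv2 T x / (circle_deriv T x)\<^sup>2\<bar> \<le> distortion T"
proof -
  obtain B where "\<And>x. \<bar>circle_deriv2 T x / (circle_deriv T x)\<^sup>2\<bar> \<le> B"
    using bounded_continuous_circle[OF continuous_distortion[OF assms]] by blast
  then have "bdd_above (range (\<lambda>x. \<bar>circle_deriv2 T x / (circle_deriv T x)\<^sup>2\<bar>))"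
    by (auto intro!: bdd_aboveI[of _ B])
  then show ?thesis
    unfolding distortion_def by (intro cSUP_upper) auto
qed

lemma distortion_nonneg:
  assumes T: "C2_circle_map T" and nz: "\<And>x. circle_deriv T x \<noteq> 0"
  shows "0 \<le> distortion T"
  by (rule order_trans[OF abs_ge_zero le_distortion[OF assms]])

section \<open>Measures with log-Lipschitz density\<close>

text \<open>For \<open>\<nu>\<close> with \<open>C\<^sup>1\<close> density \<open>h\<close>, integration by parts shows that the condition expresses
  \<open>\<bar>h'\<bar> \<le> a h\<close>.  The dual form passes to the image of \<open>\<nu>\<close> under a noninvertible map by composition of test functions, instead of a
  sum over preimages.\<close>

definition log_lipschitz :: "real \<Rightarrow> circle measure \<Rightarrow> bool" where
  "log_lipschitz a \<nu> \<longleftrightarrow> prob_space \<nu> \<and> sets \<nu> = sets borel \<and>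
     (\<forall>g g'. circle_C1 g g' \<longrightarrow> \<bar>\<integral>x. g' x \<partial>\<nu>\<bar> \<le> a * (\<integral>x. \<bar>g x\<bar> \<partial>\<nu>))"

lemma log_lipschitz_lebesgue: "log_lipschitz 0 circle_lebesgue"
  by (simp add: log_lipschitz_def prob_space_circle_lebesgue integral_circle_C1_deriv)

text \<open>Let \<open>G = (g \<circ> T) / T'\<close>.  Then \<open>G' = g' \<circ> T - (g \<circ> T) T'' / T'\<^sup>2\<close>, so integrating \<open>g' \<circ> T\<close>
  against \<open>\<nu>\<close> costs \<open>a\<close> times the integral of \<open>\<bar>G\<bar>\<close>, which is at most \<open>\<bar>g \<circ> T\<bar>\<close> over the minimal expansion,
  plus an error governed by the distortion.\<close>

lemma log_lipschitz_image:
  assumes \<nu>: "log_lipschitz a \<nu>" and a: "0 \<le> a"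
    and T: "C2_circle_map T" and nz: "\<And>x. circle_deriv T x \<noteq> 0"
  shows "log_lipschitz (a / min_expansion T + distortion T) (distr \<nu> borel T)"
proof -
  have sets[simp]: "sets \<nu> = sets borel" and p: "prob_space \<nu>"
    using \<nu> by (auto simp: log_lipschitz_def)
  note l = min_expansion_pos[OF T nz]
  have cT: "continuous_on UNIV T" by (rule C2_circle_map_continuous[OF T])
  have mT: "T \<in> \<nu> \<rightarrow>\<^sub>M borel"
    using borel_measurable_continuous_onI[OF cT] by (simp add: measurable_cong_sets[OF sets refl])
  have cTc: "continuous_on UNIV (\<lambda>x. h (T x))" if "continuous_on UNIV h" for h :: "circle \<Rightarrow> real"
    using continuous_on_compose2[OF that cT] by simp
  have cD: "continuous_on UNIV (circle_deriv T)"
    by (rule circle_C1_continuous[OF C2_circle_map_deriv_C1[OF T]])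
  have "\<bar>\<integral>x. g' (T x) \<partial>\<nu>\<bar> \<le> (a / min_expansion T + distortion T) * (\<integral>x. \<bar>g (T x)\<bar> \<partial>\<nu>)"
    if g: "circle_C1 g g'" for g g'
  proof -
    define G where "G x = g (T x) * inverse (circle_deriv T x)" for x
    define R where "R x = g (T x) * (circle_deriv2 T x / (circle_deriv T x)\<^sup>2)" for x
    have cg: "continuous_on UNIV (\<lambda>x. g (T x))" and cg': "continuous_on UNIV (\<lambda>x. g' (T x))"
      by (intro cTc circle_C1_continuous[OF g] circle_C1_D(2)[OF g])+
    have cR: "continuous_on UNIV R"
      unfolding R_def by (intro continuous_intros cg continuous_distortion[OF T nz])
    have "circle_C1 G (\<lambda>x. g' (T x) * circle_deriv T x * inverse (circle_deriv T x)
        + - (circle_deriv2 T x / (circle_deriv T x)\<^sup>2) * g (T x))"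
      unfolding G_def
      by (rule circle_C1_mult[OF circle_C1_compose[OF T g] circle_C1_inverse[OF C2_circle_map_deriv_C1[OF T] nz]])
    then have G: "circle_C1 G (\<lambda>x. g' (T x) - R x)"
      using nz by (simp add: R_def mult.assoc mult.commute[of "g _"])
    have int: "integrable \<nu> h" if "continuous_on UNIV h" for h :: "circle \<Rightarrow> real"
      by (rule integrable_continuous_circle[OF p sets that])
    have "(\<integral>x. g' (T x) \<partial>\<nu>) = (\<integral>x. g' (T x) - R x \<partial>\<nu>) + (\<integral>x. R x \<partial>\<nu>)"
      by (simp add: Bochner_Integration.integral_diff[OF int[OF cg'] int[OF cR]])
    then have "\<bar>\<integral>x. g' (T x) \<partial>\<nu>\<bar> \<le> \<bar>\<integral>x. g' (T x) - R x \<partial>\<nu>\<bar> + \<bar>\<integral>x. R x \<partial>\<nu>\<bar>"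
      by linarith
    also have "\<dots> \<le> a * (\<integral>x. \<bar>G x\<bar> \<partial>\<nu>) + (\<integral>x. \<bar>R x\<bar> \<partial>\<nu>)"
      using \<nu> G by (intro add_mono integral_abs_bound) (auto simp: log_lipschitz_def)
    also have "\<dots> \<le> a * (\<integral>x. \<bar>g (T x)\<bar> / min_expansion T \<partial>\<nu>) + (\<integral>x. distortion T * \<bar>g (T x)\<bar> \<partial>\<nu>)"
    proof (intro add_mono mult_left_mono a integral_mono)
      show "integrable \<nu> (\<lambda>x. \<bar>G x\<bar>)" by (intro int continuous_intros circle_C1_continuous[OF G])
      show "integrable \<nu> (\<lambda>x. \<bar>R x\<bar>)" by (intro int continuous_intros cR)
      show "integrable \<nu> (\<lambda>x. \<bar>g (T x)\<bar> / min_expansion T)"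
        "integrable \<nu> (\<lambda>x. distortion T * \<bar>g (T x)\<bar>)"
        using l by (auto intro!: int continuous_intros cg)
      fix x
      show "\<bar>G x\<bar> \<le> \<bar>g (T x)\<bar> / min_expansion T"
        using min_expansion_le[of T x] l nz[of x]
        by (auto simp: G_def abs_mult divide_inverse intro!: mult_left_mono)
      show "\<bar>R x\<bar> \<le> distortion T * \<bar>g (T x)\<bar>"
        using mult_left_mono[OF le_distortion[OF T nz, of x], of "\<bar>g (T x)\<bar>"]
        by (simp add: R_def abs_mult mult.commute)
    qed
    also have "\<dots> = (a / min_expansion T + distortion T) * (\<integral>x. \<bar>g (T x)\<bar> \<partial>\<nu>)"
      by (simp add: distrib_right)
    finally show ?thesis .
  qed
  moreover have "(\<integral>x. h x \<partial>distr \<nu> borel T) = (\<integral>x. h (T x) \<partial>\<nu>)" if "continuous_on UNIV h"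
    for h :: "circle \<Rightarrow> real"
    by (rule integral_distr[OF mT borel_measurable_continuous_onI[OF that]])
  ultimately show ?thesis
    using prob_space.prob_space_distr[OF p mT]
    by (auto simp: log_lipschitz_def circle_C1_D(2) circle_C1_continuous continuous_on_rabs)
qed

text \<open>With \<open>g' = u - m\<close> and \<open>\<bar>g\<bar> \<le> m\<close>, where \<open>m\<close> is the mean of \<open>u\<close>, the integrals of \<open>u\<close> with respect to \<open>\<nu>\<close> and to
  Lebesgue measure differ by at most \<open>a m\<close>.  In terms of densities: a density that satisfies
  \<open>\<bar>h'\<bar> \<le> a h\<close> has total variation at most \<open>a\<close> and mean \<open>1\<close>, hence is bounded by \<open>1 + a\<close>.\<close>

lemma log_lipschitz_integral_le:
  assumes \<nu>: "log_lipschitz a \<nu>" and a: "0 \<le> a"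
    and u: "continuous_on UNIV u" and nonneg: "\<And>x. 0 \<le> u x"
  shows "(\<integral>x. u x \<partial>\<nu>) \<le> (1 + a) * (\<integral>x. u x \<partial>circle_lebesgue)"
proof -
  have sets[simp]: "sets \<nu> = sets borel" and p: "prob_space \<nu>"
    using \<nu> by (auto simp: log_lipschitz_def)
  interpret prob_space \<nu> by (rule p)
  define m where "m = (\<integral>x. u x \<partial>circle_lebesgue)"
  obtain g where g: "circle_C1 g (\<lambda>x. u x - m)" and bd: "\<And>x. \<bar>g x\<bar> \<le> m"
    using circle_C1_antiderivative[OF u nonneg] unfolding m_def by blast
  have "(\<integral>x. u x \<partial>\<nu>) - m = (\<integral>x. u x - m \<partial>\<nu>)"
    by (simp add: Bochner_Integration.integral_diff integrable_continuous_circle[OF p sets u] prob_space)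
  also have "\<dots> \<le> a * (\<integral>x. \<bar>g x\<bar> \<partial>\<nu>)"
    using \<nu> g by (auto simp: log_lipschitz_def dest!: spec intro: order_trans[OF abs_ge_self])
  also have "\<dots> \<le> a * (\<integral>x. m \<partial>\<nu>)"
    using bd a by (intro mult_left_mono integral_mono integrable_continuous_circle[OF p sets]
        continuous_intros circle_C1_continuous[OF g]) auto
  also have "\<dots> = a * m" by (simp add: prob_space)
  finally show ?thesis by (simp add: m_def algebra_simps)
qed

section \<open>Measurability and the Markov operator\<close>

lemma borel_measurable_circle_diff [measurable (raw)]:
  assumes [measurable]: "f \<in> M \<rightarrow>\<^sub>M borel" "g \<in> M \<rightarrow>\<^sub>M borel"
  shows "(\<lambda>w. circle_diff (f w) (g w)) \<in> borel_measurable M"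
  unfolding circle_diff_def round_def by measurable

lemma LIMSEQ_difference_quotient:
  fixes f :: "real \<Rightarrow> real"
  assumes "(f has_real_derivative D) (at a)"
  shows "(\<lambda>n. (f (a + inverse (real (Suc n))) - f a) / inverse (real (Suc n))) \<longlonglongrightarrow> D"
proof -
  have "((\<lambda>h. (f (a + h) - f a) / h) \<longlongrightarrow> D) (at 0)"
    using assms by (simp add: DERIV_def)
  moreover have "filterlim (\<lambda>n. inverse (real (Suc n))) (at 0) sequentially"
    unfolding filterlim_at using LIMSEQ_inverse_real_of_nat by auto
  ultimately show ?thesis by (rule filterlim_compose)
qed

lemma continuous_circle_le_iff_rational:
  fixes f :: "circle \<Rightarrow> real"
  assumes "continuous_on UNIV f"
  shows "(\<forall>x. f x \<le> c) \<longleftrightarrow> (\<forall>q::rat. f (circle_of (of_rat q)) \<le> c)"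
proof
  assume r: "\<forall>q::rat. f (circle_of (of_rat q)) \<le> c"
  have "continuous_on UNIV (\<lambda>t. f (circle_of t))"
    using continuous_on_compose2[OF assms continuous_on_circle_of] by simp
  then have "closed {t. f (circle_of t) \<le> c}"
    by (intro closed_Collect_le continuous_intros)
  then have "closure \<rat> \<subseteq> {t. f (circle_of t) \<le> c}"
    using r by (intro closure_minimal) (auto simp: Rats_def)
  then have "f (circle_of t) \<le> c" for t
    by (auto simp: Rats_closure_real)
  then show "\<forall>x. f x \<le> c" by (metis circle_of_coord)
qed simp

locale random_circle_maps = prob_space \<eta> for \<eta> :: "'w measure" +
  fixes T :: "'w \<Rightarrow> circle \<Rightarrow> circle"
  assumes C2: "w \<in> space \<eta> \<Longrightarrow> C2_circle_map (T w)"
    and deriv_nonzero: "w \<in> space \<eta> \<Longrightarrow> circle_deriv (T w) x \<noteq> 0"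
    and measurable_T: "(\<lambda>(w, x). T w x) \<in> \<eta> \<Otimes>\<^sub>M borel \<rightarrow>\<^sub>M borel"
begin

lemma measurable_T_comp [measurable (raw)]:
  assumes "g \<in> N \<rightarrow>\<^sub>M \<eta>" "h \<in> N \<rightarrow>\<^sub>M borel"
  shows "(\<lambda>u. T (g u) (h u)) \<in> N \<rightarrow>\<^sub>M borel"
  using measurable_compose[OF measurable_Pair[OF assms] measurable_T] by simp

lemma continuous_T: "w \<in> space \<eta> \<Longrightarrow> continuous_on UNIV (T w)"
  by (rule C2_circle_map_continuous[OF C2])

lemma continuous_deriv: "w \<in> space \<eta> \<Longrightarrow> continuous_on UNIV (circle_deriv (T w))"
  by (rule circle_C1_continuous[OF C2_circle_map_deriv_C1[OF C2]])

text \<open>Derivatives at a fixed point are limits of difference quotients along a sequence, and the extrema that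
  define expansion and distortion can be taken over the countable set of points with rational coordinate.  Hence these
  quantities are genuine random variables, and the hypotheses on their moments can be
  used additively.\<close>

lemma borel_measurable_deriv [measurable]: "(\<lambda>w. circle_deriv (T w) x) \<in> borel_measurable \<eta>"
proof (rule borel_measurable_LIMSEQ_real)
  let ?u = "\<lambda>n w. (circle_displacement (T w) x (0 + inverse (real (Suc n)))
    - circle_displacement (T w) x 0) / inverse (real (Suc n))"
  show "?u n \<in> borel_measurable \<eta>" for n
    unfolding circle_displacement_def by measurable
  fix w assume "w \<in> space \<eta>"
  then have "(circle_displacement (T w) x has_real_derivative circle_deriv (T w) x) (at 0)"
    using C2 field_differentiable_derivI unfolding C2_circle_map_def circle_deriv_def by blast
  then show "(\<lambda>n. ?u n w) \<longlonglongrightarrow> circle_deriv (T w) x"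
    by (rule LIMSEQ_difference_quotient)
qed

lemma borel_measurable_deriv2 [measurable]: "(\<lambda>w. circle_deriv2 (T w) x) \<in> borel_measurable \<eta>"
proof (rule borel_measurable_LIMSEQ_real)
  let ?u = "\<lambda>n w. (circle_deriv (T w) (circle_of (coord x + inverse (real (Suc n))))
    - circle_deriv (T w) (circle_of (coord x))) / inverse (real (Suc n))"
  show "?u n \<in> borel_measurable \<eta>" for n by measurable
  fix w assume "w \<in> space \<eta>"
  then have "((\<lambda>t. circle_deriv (T w) (circle_of t)) has_real_derivative circle_deriv2 (T w) (circle_of (coord x)))
    (at (coord x))"
    by (intro circle_C1_D(1) C2_circle_map_deriv_C1 C2)
  then have "(\<lambda>n. ?u n w) \<longlonglongrightarrow> circle_deriv2 (T w) (circle_of (coord x))"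
    by (rule LIMSEQ_difference_quotient)
  then show "(\<lambda>n. ?u n w) \<longlonglongrightarrow> circle_deriv2 (T w) x"
    by (simp only: circle_of_coord)
qed

lemma pred_deriv_bounded [measurable]: "Measurable.pred \<eta> (\<lambda>w. \<forall>x. \<bar>circle_deriv (T w) x\<bar> \<le> c)"
proof -
  have "Measurable.pred \<eta> (\<lambda>w. \<forall>q::rat. \<bar>circle_deriv (T w) (circle_of (of_rat q))\<bar> \<le> c)"
    by measurable
  moreover have "(\<forall>q::rat. \<bar>circle_deriv (T w) (circle_of (of_rat q))\<bar> \<le> c) \<longleftrightarrow> (\<forall>x. \<bar>circle_deriv (T w) x\<bar> \<le> c)"
    if "w \<in> space \<eta>" for w
    using continuous_circle_le_iff_rational[of "\<lambda>x. \<bar>circle_deriv (T w) x\<bar>" c]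
    by (simp add: continuous_deriv[OF that] continuous_on_rabs)
  ultimately show ?thesis by (simp cong: measurable_cong)
qed

lemma borel_measurable_min_expansion [measurable]: "(\<lambda>w. min_expansion (T w)) \<in> borel_measurable \<eta>"
proof (rule borel_measurable_iff_ge[THEN iffD2, rule_format])
  fix a
  have "(\<forall>q::rat. a \<le> \<bar>circle_deriv (T w) (circle_of (of_rat q))\<bar>) \<longleftrightarrow> a \<le> min_expansion (T w)"
    if "w \<in> space \<eta>" for w
  proof -
    have "a \<le> min_expansion (T w) \<longleftrightarrow> (\<forall>x. a \<le> \<bar>circle_deriv (T w) x\<bar>)"
      using min_expansion_le[of "T w"] unfolding min_expansion_def
      by (auto intro: order_trans intro!: cINF_greatest)
    then show ?thesis
      using continuous_circle_le_iff_rational[of "\<lambda>x. - \<bar>circle_deriv (T w) x\<bar>" "-a"]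
      by (simp add: continuous_deriv[OF that] continuous_on_rabs continuous_on_minus)
  qed
  then have "{w \<in> space \<eta>. a \<le> min_expansion (T w)} =
    {w \<in> space \<eta>. \<forall>q::rat. a \<le> \<bar>circle_deriv (T w) (circle_of (of_rat q))\<bar>}" by auto
  moreover have "Measurable.pred \<eta> (\<lambda>w. \<forall>q::rat. a \<le> \<bar>circle_deriv (T w) (circle_of (of_rat q))\<bar>)"
    by measurable
  ultimately show "{w \<in> space \<eta>. a \<le> min_expansion (T w)} \<in> sets \<eta>"
    by (simp add: pred_def)
qed

lemma borel_measurable_distortion [measurable]: "(\<lambda>w. distortion (T w)) \<in> borel_measurable \<eta>"
proof (rule borel_measurable_iff_le[THEN iffD2, rule_format])
  fix a
  let ?f = "\<lambda>w x. \<bar>circle_deriv2 (T w) x / (circle_deriv (T w) x)\<^sup>2\<bar>"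
  have "(\<forall>q::rat. ?f w (circle_of (of_rat q)) \<le> a) \<longleftrightarrow> distortion (T w) \<le> a"
    if "w \<in> space \<eta>" for w
  proof -
    have "distortion (T w) \<le> a \<longleftrightarrow> (\<forall>x. ?f w x \<le> a)"
      using le_distortion[OF C2 deriv_nonzero, OF that that]
      by (auto intro: order_trans intro!: cSUP_least simp: distortion_def[of "T w"])
    then show ?thesis
      using continuous_circle_le_iff_rational[of "?f w" a]
        continuous_distortion[OF C2 deriv_nonzero, OF that that]
      by (simp only: continuous_on_rabs)
  qed
  then have "{w \<in> space \<eta>. distortion (T w) \<le> a} = {w \<in> space \<eta>. \<forall>q::rat. ?f w (circle_of (of_rat q)) \<le> a}"
    by auto
  moreover have "Measurable.pred \<eta> (\<lambda>w. \<forall>q::rat. ?f w (circle_of (of_rat q)) \<le> a)"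
    by measurable
  ultimately show "{w \<in> space \<eta>. distortion (T w) \<le> a} \<in> sets \<eta>"
    by (simp add: pred_def)
qed

abbreviation Q :: "(circle \<Rightarrow> real) \<Rightarrow> circle \<Rightarrow> real" where "Q \<equiv> markov_op \<eta> T"

lemma markov_op_bounded:
  assumes "\<And>x. \<bar>f x\<bar> \<le> B" and f: "f \<in> borel_measurable borel"
  shows "\<bar>Q f x\<bar> \<le> B"
proof -
  have "0 \<le> B" by (rule order_trans[OF abs_ge_zero assms(1)])
  have "\<bar>Q f x\<bar> \<le> (\<integral>w. \<bar>f (T w x)\<bar> \<partial>\<eta>)"
    unfolding markov_op_def by (rule integral_abs_bound)
  also have "\<dots> \<le> (\<integral>w. B \<partial>\<eta>)"
    using f assms(1) \<open>0 \<le> B\<close> by (intro integral_mono integrable_const_bound[of _ B]) auto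
  finally show ?thesis by (simp add: prob_space)
qed

lemma borel_measurable_markov_op [measurable]:
  assumes [measurable]: "f \<in> borel_measurable borel"
  shows "Q f \<in> borel_measurable borel"
  unfolding markov_op_def by measurable

lemma markov_op_power:
  assumes "f \<in> borel_measurable borel" "\<And>x. \<bar>f x\<bar> \<le> B"
  shows "(Q ^^ n) f \<in> borel_measurable borel" "\<bar>(Q ^^ n) f x\<bar> \<le> B"
proof -
  have "(Q ^^ n) f \<in> borel_measurable borel \<and> (\<forall>x. \<bar>(Q ^^ n) f x\<bar> \<le> B)"
    by (induction n) (use assms markov_op_bounded in auto)
  then show "(Q ^^ n) f \<in> borel_measurable borel" "\<bar>(Q ^^ n) f x\<bar> \<le> B" by auto
qed

lemma integral_markov_op_swap:
  fixes N :: "'z measure"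
  assumes N: "finite_measure N" and h[measurable]: "h \<in> N \<rightarrow>\<^sub>M borel"
    and f[measurable]: "f \<in> borel_measurable borel" and B: "\<And>x. \<bar>f x\<bar> \<le> B"
  shows "(\<integral>z. Q f (h z) \<partial>N) = (\<integral>w. \<integral>z. f (T w (h z)) \<partial>N \<partial>\<eta>)"
    and "integrable \<eta> (\<lambda>w. \<integral>z. f (T w (h z)) \<partial>N)"
proof -
  interpret N: finite_measure N by (rule N)
  interpret P: pair_sigma_finite \<eta> N ..
  interpret PF: finite_measure "\<eta> \<Otimes>\<^sub>M N"
    by (rule finite_measure_pair_measure) (unfold_locales)
  have int: "integrable (\<eta> \<Otimes>\<^sub>M N) (\<lambda>(w, z). f (T w (h z)))"
    by (rule PF.integrable_const_bound[of _ B]) (auto simp: B)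
  show "(\<integral>z. Q f (h z) \<partial>N) = (\<integral>w. \<integral>z. f (T w (h z)) \<partial>N \<partial>\<eta>)"
    unfolding markov_op_def by (rule P.Fubini_integral[OF int])
  show "integrable \<eta> (\<lambda>w. \<integral>z. f (T w (h z)) \<partial>N)"
    by (rule P.integrable_fst[OF int])
qed

end



section \<open>Uniform regularity of the iterates\<close>

locale expanding_on_average = random_circle_maps +
  assumes expansion: "(\<integral>\<^sup>+ w. ennreal (1 / (min_expansion (T w))\<^sup>2) \<partial>\<eta>) < 1"
    and distortion_L2: "(\<integral>\<^sup>+ w. ennreal ((distortion (T w))\<^sup>2) \<partial>\<eta>) < \<infinity>"
begin

text \<open>The constant of \<open>log_lipschitz\<close> evolves by the random affine recursion
  \<open>a \<mapsto> a / \<lambda> + \<Delta>\<close>.  Its second moment contracts because the second moment of \<open>1 / \<lambda>\<close> is below \<open>1\<close>: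
  Young's inequality with a small weight \<open>e\<close> separates the square into a contracting part and a bounded
  remainder.  The remainder is written as \<open>(1 - \<rho>) c\<close>, so that \<open>c\<close> is the fixed point of the resulting recursion.\<close>

lemma log_lipschitz_constant_drift:
  obtains \<rho> c where "0 \<le> \<rho>" "\<rho> < 1" "0 \<le> c"
    "\<And>a. 0 \<le> a \<Longrightarrow> integrable \<eta> (\<lambda>w. (a / min_expansion (T w) + distortion (T w))\<^sup>2)"
    "\<And>a. 0 \<le> a \<Longrightarrow> (\<integral>w. (a / min_expansion (T w) + distortion (T w))\<^sup>2 \<partial>\<eta>) \<le> \<rho> * a\<^sup>2 + (1 - \<rho>) * c"
proof -
  let ?l = "\<lambda>w. 1 / (min_expansion (T w))\<^sup>2" and ?d = "\<lambda>w. (distortion (T w))\<^sup>2"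
  define \<theta> where "\<theta> = (\<integral>w. ?l w \<partial>\<eta>)"
  define D where "D = (\<integral>w. ?d w \<partial>\<eta>)"
  have intl: "integrable \<eta> ?l"
  proof (rule integrableI_bounded)
    show "(\<integral>\<^sup>+ w. norm (?l w) \<partial>\<eta>) < \<infinity>"
      using expansion by (simp add: less_le_trans[OF _ top_greatest])
  qed simp
  have intd: "integrable \<eta> ?d"
    by (rule integrableI_bounded) (use distortion_L2 in simp_all)
  have "ennreal \<theta> < 1"
    using expansion nn_integral_eq_integral[OF intl] by (simp add: \<theta>_def)
  moreover have \<theta>0: "0 \<le> \<theta>" and D0: "0 \<le> D" by (auto simp: \<theta>_def D_def)
  ultimately have \<theta>1: "\<theta> < 1" using ennreal_less_iff[of \<theta> 1] by simp
  \<comment> \<open>this weight makes \<open>1 - \<rho>\<close> factor as \<open>(1 - \<theta>) (1 - \<theta> / 2)\<close>\<close>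
  define e where "e = (1 - \<theta>) / 2"
  have e: "0 < e" using \<theta>1 by (simp add: e_def)
  define \<rho> where "\<rho> = (1 + e) * \<theta>"
  have "1 - \<rho> = (1 - \<theta>) * (1 - \<theta> / 2)"
    by (simp add: \<rho>_def e_def field_simps)
  moreover have "0 < (1 - \<theta>) * (1 - \<theta> / 2)" using \<theta>1 by simp
  ultimately have \<rho>: "0 \<le> \<rho>" "\<rho> < 1"
    using \<theta>0 e by (auto simp: \<rho>_def)
  define c where "c = (1 + 1 / e) * D / (1 - \<rho>)"
  have c: "0 \<le> c" "(1 - \<rho>) * c = (1 + 1 / e) * D" using \<rho> e D0 by (simp_all add: c_def)
  have bd: "(a / min_expansion (T w) + distortion (T w))\<^sup>2 \<le> (1 + e) * a\<^sup>2 * ?l w + (1 + 1 / e) * ?d w" for a w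
  proof -
    have "(x + y)\<^sup>2 \<le> (1 + e) * x\<^sup>2 + (1 + 1 / e) * y\<^sup>2" for x y :: real
    proof -
      have "(1 + e) * x\<^sup>2 + (1 + 1 / e) * y\<^sup>2 - (x + y)\<^sup>2 = (e * x - y)\<^sup>2 / e"
        using e by (simp add: field_simps power2_eq_square)
      moreover have "0 \<le> (e * x - y)\<^sup>2 / e" using e by simp
      ultimately show ?thesis by linarith
    qed
    from this[of "a / min_expansion (T w)" "distortion (T w)"] show ?thesis
      by (simp add: power_divide)
  qed
  have int: "integrable \<eta> (\<lambda>w. (1 + e) * a\<^sup>2 * ?l w + (1 + 1 / e) * ?d w)" for a
    using intl intd by (intro Bochner_Integration.integrable_add integrable_mult_right)
  have int': "integrable \<eta> (\<lambda>w. (a / min_expansion (T w) + distortion (T w))\<^sup>2)" for a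
  proof (rule Bochner_Integration.integrable_bound[OF int, of _ a])
    have "norm ((a / min_expansion (T w) + distortion (T w))\<^sup>2)
      \<le> norm ((1 + e) * a\<^sup>2 * ?l w + (1 + 1 / e) * ?d w)" for w
      using order_trans[OF bd[of a w] abs_ge_self] by simp
    then show "AE w in \<eta>. norm ((a / min_expansion (T w) + distortion (T w))\<^sup>2)
      \<le> norm ((1 + e) * a\<^sup>2 * ?l w + (1 + 1 / e) * ?d w)" by blast
  qed measurable
  have dr: "(\<integral>w. (a / min_expansion (T w) + distortion (T w))\<^sup>2 \<partial>\<eta>) \<le> \<rho> * a\<^sup>2 + (1 - \<rho>) * c" for a
  proof -
    have "(\<integral>w. (a / min_expansion (T w) + distortion (T w))\<^sup>2 \<partial>\<eta>)
      \<le> (\<integral>w. (1 + e) * a\<^sup>2 * ?l w + (1 + 1 / e) * ?d w \<partial>\<eta>)"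
      by (rule integral_mono[OF int' int bd])
    also have "\<dots> = (1 + e) * a\<^sup>2 * \<theta> + (1 + 1 / e) * D"
      using intl intd unfolding \<theta>_def D_def
      by (subst Bochner_Integration.integral_add) (simp_all only: integrable_mult_right integral_mult_right_zero)
    also have "\<dots> = \<rho> * a\<^sup>2 + (1 - \<rho>) * c"
      unfolding c(2) by (simp add: \<rho>_def mult_ac)
    finally show ?thesis .
  qed
  show ?thesis by (rule that[OF \<rho> c(1)]) (rule int' dr)+
qed

text \<open>This is the uniform Lipschitz bound for the densities of the chain started from Lebesgue measure, in
  dual form.  A density with constant \<open>a\<close> has Lipschitz constant at most \<open>a (1 + a)\<close>, which is quadratic
  in \<open>a\<close>; this is where second moments are needed.  The induction removes the first step of the
  chain: conditionally on it, the remaining steps start from an image of the initial measure, whose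
  constant is a random variable with controlled second moment.  The induction hypothesis must
  therefore range over all initial measures and keep the dependence on \<open>a\<close>.\<close>

lemma markov_op_power_deriv_bound:
  obtains K where "0 \<le> K"
    "\<And>n g g'. circle_C1 g g' \<Longrightarrow>
       \<bar>\<integral>x. (Q ^^ n) g' x \<partial>circle_lebesgue\<bar> \<le> K * (\<integral>x. \<bar>g x\<bar> \<partial>circle_lebesgue)"
proof -
  obtain \<rho> c where \<rho>: "0 \<le> \<rho>" "\<rho> < 1" and c: "0 \<le> c"
    and int: "\<And>a. 0 \<le> a \<Longrightarrow> integrable \<eta> (\<lambda>w. (a / min_expansion (T w) + distortion (T w))\<^sup>2)"
    and drift: "\<And>a. 0 \<le> a \<Longrightarrow>
      (\<integral>w. (a / min_expansion (T w) + distortion (T w))\<^sup>2 \<partial>\<eta>) \<le> \<rho> * a\<^sup>2 + (1 - \<rho>) * c"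
    by (rule log_lipschitz_constant_drift) (rule that; simp)
  have main: "\<bar>\<integral>x. (Q ^^ n) g' x \<partial>\<nu>\<bar>
      \<le> (1 + 2 * c + 2 * \<rho> ^ n * (a\<^sup>2 - c)) * (\<integral>x. \<bar>g x\<bar> \<partial>circle_lebesgue)"
    if g: "circle_C1 g g'" and "0 \<le> a" "log_lipschitz a \<nu>" for n g g' a \<nu>
    using that(2,3)
  proof (induction n arbitrary: a \<nu>)
    case (0 a \<nu>)
    have "\<bar>\<integral>x. g' x \<partial>\<nu>\<bar> \<le> a * (\<integral>x. \<bar>g x\<bar> \<partial>\<nu>)"
      using 0 g by (auto simp: log_lipschitz_def)
    also have "\<dots> \<le> a * ((1 + a) * (\<integral>x. \<bar>g x\<bar> \<partial>circle_lebesgue))"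
      using 0 by (intro mult_left_mono log_lipschitz_integral_le continuous_on_rabs circle_C1_continuous[OF g]) auto
    also have "\<dots> = (a + a\<^sup>2) * (\<integral>x. \<bar>g x\<bar> \<partial>circle_lebesgue)"
      by (simp add: algebra_simps power2_eq_square)
    also have "\<dots> \<le> (1 + 2 * a\<^sup>2) * (\<integral>x. \<bar>g x\<bar> \<partial>circle_lebesgue)"
    proof (intro mult_right_mono)
      have "0 \<le> (1 - a)\<^sup>2" by simp
      then show "a + a\<^sup>2 \<le> 1 + 2 * a\<^sup>2"
        using \<open>0 \<le> a\<close> unfolding power2_diff by simp
    qed simp
    finally show ?case by (simp add: algebra_simps)
  next
    case (Suc n a \<nu>)
    let ?G = "\<integral>x. \<bar>g x\<bar> \<partial>circle_lebesgue" and ?a = "\<lambda>w. a / min_expansion (T w) + distortion (T w)"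
    have sets: "sets \<nu> = sets borel" and p: "prob_space \<nu>"
      using Suc.prems by (auto simp: log_lipschitz_def)
    have fin: "finite_measure \<nu>" using p by (rule prob_space.axioms)
    have cg': "continuous_on UNIV g'" by (rule circle_C1_D[OF g])
    obtain B where B: "\<And>x. \<bar>g' x\<bar> \<le> B"
      using bounded_continuous_circle[OF cg'] by blast
    note Qn = markov_op_power[of g' B n, OF borel_measurable_continuous_onI[OF cg'] B]
    have id: "(\<lambda>x. x) \<in> \<nu> \<rightarrow>\<^sub>M borel" by (simp add: measurable_cong_sets[OF sets refl])
    have step: "\<bar>\<integral>x. (Q ^^ n) g' (T w x) \<partial>\<nu>\<bar> \<le> (1 + 2 * c + 2 * \<rho> ^ n * ((?a w)\<^sup>2 - c)) * ?G"
      if w: "w \<in> space \<eta>" for w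
    proof -
      have "log_lipschitz (?a w) (distr \<nu> borel (T w))"
        by (rule log_lipschitz_image[OF Suc.prems(2,1) C2[OF w] deriv_nonzero[OF w]])
      moreover have "0 \<le> ?a w"
        using Suc.prems(1) min_expansion_pos[OF C2[OF w] deriv_nonzero[OF w]]
          distortion_nonneg[OF C2[OF w] deriv_nonzero[OF w]] by simp
      ultimately have "\<bar>\<integral>x. (Q ^^ n) g' x \<partial>distr \<nu> borel (T w)\<bar>
          \<le> (1 + 2 * c + 2 * \<rho> ^ n * ((?a w)\<^sup>2 - c)) * ?G"
        by (intro Suc.IH)
      moreover have "T w \<in> \<nu> \<rightarrow>\<^sub>M borel"
        using borel_measurable_continuous_onI[OF continuous_T[OF w]]
        by (simp add: measurable_cong_sets[OF sets refl])
      ultimately show ?thesis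
        using integral_distr[of "T w" \<nu> borel "(Q ^^ n) g'"] Qn(1) by simp
    qed
    have intr: "integrable \<eta> (\<lambda>w. (1 + 2 * c + 2 * \<rho> ^ n * ((?a w)\<^sup>2 - c)) * ?G)"
      using int[OF Suc.prems(1)] by simp
    note swap = integral_markov_op_swap[OF fin id Qn]
    have "\<bar>\<integral>x. (Q ^^ Suc n) g' x \<partial>\<nu>\<bar> = \<bar>\<integral>w. \<integral>x. (Q ^^ n) g' (T w x) \<partial>\<nu> \<partial>\<eta>\<bar>"
      by (simp only: swap(1) funpow.simps o_apply)
    also have "\<dots> \<le> (\<integral>w. \<bar>\<integral>x. (Q ^^ n) g' (T w x) \<partial>\<nu>\<bar> \<partial>\<eta>)"
      by (rule integral_abs_bound)
    also have "\<dots> \<le> (\<integral>w. (1 + 2 * c + 2 * \<rho> ^ n * ((?a w)\<^sup>2 - c)) * ?G \<partial>\<eta>)"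
      by (intro integral_mono integrable_abs swap(2) intr step)
    also have "\<dots> = (1 + 2 * c + 2 * \<rho> ^ n * ((\<integral>w. (?a w)\<^sup>2 \<partial>\<eta>) - c)) * ?G"
      using int[OF Suc.prems(1)] by (simp add: prob_space)
    also have "\<dots> \<le> (1 + 2 * c + 2 * \<rho> ^ n * ((\<rho> * a\<^sup>2 + (1 - \<rho>) * c) - c)) * ?G"
      using drift[OF Suc.prems(1)] \<rho>(1)
      by (intro mult_right_mono add_left_mono mult_left_mono diff_right_mono) auto
    also have "\<dots> = (1 + 2 * c + 2 * \<rho> ^ Suc n * (a\<^sup>2 - c)) * ?G"
      by (simp add: algebra_simps)
    finally show ?case .
  qed
  show ?thesis
  proof (rule that[of "1 + 2 * c"])
    show "0 \<le> 1 + 2 * c" using c by simp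
    fix n g g' assume g: "circle_C1 g g'"
    have "\<bar>\<integral>x. (Q ^^ n) g' x \<partial>circle_lebesgue\<bar>
        \<le> (1 + 2 * c + 2 * \<rho> ^ n * (0\<^sup>2 - c)) * (\<integral>x. \<bar>g x\<bar> \<partial>circle_lebesgue)"
      by (rule main[OF g order_refl log_lipschitz_lebesgue])
    also have "\<dots> \<le> (1 + 2 * c) * (\<integral>x. \<bar>g x\<bar> \<partial>circle_lebesgue)"
      using \<rho>(1) c by (intro mult_right_mono) auto
    finally show "\<bar>\<integral>x. (Q ^^ n) g' x \<partial>circle_lebesgue\<bar> \<le> (1 + 2 * c) * (\<integral>x. \<bar>g x\<bar> \<partial>circle_lebesgue)" .
  qed
qed

end



section \<open>Distributions of the chain\<close>

context random_circle_maps
begin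

text \<open>One step of the chain on distributions, dual to the Markov operator.\<close>

definition push :: "circle measure \<Rightarrow> circle measure" where
  "push \<nu> = distr (\<eta> \<Otimes>\<^sub>M \<nu>) borel (\<lambda>(w, x). T w x)"

lemma sets_push [simp]: "sets (push \<nu>) = sets borel"
  by (simp add: push_def)

lemma measurable_push:
  assumes "sets \<nu> = sets borel"
  shows "(\<lambda>(w, x). T w x) \<in> \<eta> \<Otimes>\<^sub>M \<nu> \<rightarrow>\<^sub>M borel"
  using measurable_T by (simp add: measurable_cong_sets[OF sets_pair_measure_cong[OF refl assms] refl])

lemma prob_space_push:
  assumes \<nu>: "prob_space \<nu>" "sets \<nu> = sets borel"
  shows "prob_space (push \<nu>)"
proof -
  interpret N: prob_space \<nu> by (rule \<nu>)
  interpret P: pair_prob_space \<eta> \<nu> ..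
  show ?thesis unfolding push_def by (rule P.prob_space_distr[OF measurable_push[OF \<nu>(2)]])
qed

lemma integral_push:
  assumes \<nu>: "prob_space \<nu>" "sets \<nu> = sets borel"
    and f: "f \<in> borel_measurable borel" and B: "\<And>x. \<bar>f x\<bar> \<le> B"
  shows "(\<integral>x. f x \<partial>push \<nu>) = (\<integral>x. Q f x \<partial>\<nu>)"
proof -
  interpret N: prob_space \<nu> by (rule \<nu>)
  interpret P: pair_prob_space \<eta> \<nu> ..
  have "integrable (\<eta> \<Otimes>\<^sub>M \<nu>) (\<lambda>u. f (case u of (w, x) \<Rightarrow> T w x))"
    using measurable_compose[OF measurable_push[OF \<nu>(2)] f]
    by (intro P.integrable_const_bound[of _ B]) (auto simp: B)
  then have "integrable (\<eta> \<Otimes>\<^sub>M \<nu>) (\<lambda>(w, x). f (T w x))"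
    by (simp add: case_prod_beta')
  from P.integral_snd[OF this]
  have "(\<integral>x. Q f x \<partial>\<nu>) = (\<integral>u. f (case u of (w, x) \<Rightarrow> T w x) \<partial>(\<eta> \<Otimes>\<^sub>M \<nu>))"
    by (simp add: markov_op_def case_prod_beta')
  also have "\<dots> = (\<integral>x. f x \<partial>push \<nu>)"
    unfolding push_def by (rule integral_distr[OF measurable_push[OF \<nu>(2)] f, symmetric])
  finally show ?thesis by (rule sym)
qed

lemma push_power:
  "prob_space ((push ^^ n) circle_lebesgue)" "sets ((push ^^ n) circle_lebesgue) = sets borel"
proof -
  show "sets ((push ^^ n) circle_lebesgue) = sets borel" for n
    by (cases n) simp_all
  then show "prob_space ((push ^^ n) circle_lebesgue)"
    by (induction n) (simp_all add: prob_space_circle_lebesgue prob_space_push)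
qed

lemma integral_push_power:
  assumes f: "f \<in> borel_measurable borel" and B: "\<And>x. \<bar>f x\<bar> \<le> B"
  shows "(\<integral>x. f x \<partial>(push ^^ n) circle_lebesgue) = (\<integral>x. (Q ^^ n) f x \<partial>circle_lebesgue)"
  using assms
proof (induction n arbitrary: f)
  case (Suc n)
  have "(\<integral>x. f x \<partial>(push ^^ Suc n) circle_lebesgue) = (\<integral>x. Q f x \<partial>(push ^^ n) circle_lebesgue)"
    using integral_push[OF push_power Suc.prems] by simp
  also have "\<dots> = (\<integral>x. (Q ^^ n) (Q f) x \<partial>circle_lebesgue)"
    using Suc.prems by (intro Suc.IH borel_measurable_markov_op markov_op_bounded)
  finally show ?case by (simp add: funpow_swap1)
qed simp

end



section \<open>Mollification\<close>

text \<open>The antiderivative of \<open>u\<close> is bounded by the mean of \<open>u\<close>, so it vanishes, and with it its derivative.\<close>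

lemma integral_continuous_zero:
  fixes u :: "circle \<Rightarrow> real"
  assumes u: "continuous_on UNIV u" "\<And>x. 0 \<le> u x" and z: "(\<integral>x. u x \<partial>circle_lebesgue) = 0"
  shows "u x = 0"
proof -
  obtain g where g: "circle_C1 g u" "\<And>x. g x = 0"
    using circle_C1_antiderivative[OF u] by (auto simp: z)
  have "((\<lambda>_. 0) has_real_derivative u (circle_of (coord x))) (at (coord x))"
    using circle_C1_D(1)[OF g(1)] by (simp add: g(2))
  from DERIV_unique[OF this DERIV_const] show ?thesis
    by (simp add: circle_of_coord)
qed

lemma exists_kernel:
  fixes e :: real
  assumes "0 < e"
  obtains k :: "circle \<Rightarrow> real" where "continuous_on UNIV k" "\<And>x. 0 \<le> k x"
    "(\<integral>x. k x \<partial>circle_lebesgue) = 1" "\<And>x. e \<le> dist x (circle_of 0) \<Longrightarrow> k x = 0"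
proof -
  define b where "b x = max 0 (e - dist x (circle_of 0))" for x
  define c where "c = (\<integral>x. b x \<partial>circle_lebesgue)"
  have b: "continuous_on UNIV b" "\<And>x. 0 \<le> b x"
    unfolding b_def by (intro continuous_intros) simp
  have b0: "b x = 0" if "e \<le> dist x (circle_of 0)" for x
    using that by (simp add: b_def)
  have "b (circle_of 0) \<noteq> 0" using assms by (simp add: b_def)
  then have "c \<noteq> 0" using integral_continuous_zero[OF b] unfolding c_def by blast
  moreover have "0 \<le> c" unfolding c_def by (simp add: b)
  ultimately have "0 < c" by simp
  then show ?thesis
    by (intro that[of "\<lambda>x. b x / c"]) (auto intro!: continuous_intros b simp: b(2) b0 c_def[symmetric])
qed

text \<open>Convolution of \<open>\<nu>\<close> with the reflected kernel \<open>k\<close>: it turns the dual form of the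
  Lipschitz bound into a bound on an actual density.\<close>

definition mollify :: "(circle \<Rightarrow> real) \<Rightarrow> circle measure \<Rightarrow> circle \<Rightarrow> real" where
  "mollify k \<nu> x = (\<integral>y. k (circle_of (coord y - coord x)) \<partial>\<nu>)"

lemma circle_of_coord_diff: "circle_of (coord (circle_of t) - s) = circle_of (t - s)"
  using circle_of_coord_add[of t "- s"] by simp

lemma circle_of_diff_coord: "circle_of (s - coord (circle_of t)) = circle_of (s - t)"
proof -
  have "s - coord (circle_of t) = (s - t) + of_int \<lfloor>t\<rfloor>"
    by (simp add: coord_circle_of frac_def)
  then show ?thesis by (metis circle_of_add_int)
qed

lemma continuous_rotate:
  fixes k :: "circle \<Rightarrow> real"
  assumes "continuous_on UNIV k"
  shows "continuous_on UNIV (\<lambda>y. k (circle_of (coord y - s)))"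
proof (rule continuous_circleI)
  have "continuous_on UNIV (\<lambda>t. circle_of (t - s))"
    by (rule continuous_on_compose2[OF continuous_on_circle_of]) (auto intro!: continuous_intros)
  then show "continuous_on UNIV (\<lambda>t. k (circle_of (coord (circle_of t) - s)))"
    using continuous_on_compose2[OF assms] by (simp add: circle_of_coord_diff)
qed

text \<open>The difference of two translates of \<open>k\<close> is the derivative of the difference \<open>G\<close> of two translates of a
  monotone antiderivative \<open>F\<close> of \<open>k\<close>.  By monotonicity \<open>G\<close> has a constant sign, and since \<open>F\<close> grows by \<open>1\<close> over
  each period, the integral of \<open>G\<close> is exactly the distance of translation.\<close>

lemma mollify_lipschitz:
  assumes k: "continuous_on UNIV k" "\<And>x. 0 \<le> k x" "(\<integral>x. k x \<partial>circle_lebesgue) = 1"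
    and \<nu>: "prob_space \<nu>" "sets \<nu> = sets borel"
    and K: "\<And>g g'. circle_C1 g g' \<Longrightarrow> \<bar>\<integral>x. g' x \<partial>\<nu>\<bar> \<le> K * (\<integral>x. \<bar>g x\<bar> \<partial>circle_lebesgue)"
  shows "\<bar>mollify k \<nu> x - mollify k \<nu> z\<bar> \<le> K * dist x z"
proof -
  obtain F where F: "\<And>t. (F has_real_derivative k (circle_of t)) (at t)"
    and F1: "\<And>t. F (t + 1) = F t + 1"
    using antiderivative_circle_lift[OF k(1)] k(3) by metis
  have "isCont F t" for t using F by (rule DERIV_isCont)
  then have cF: "continuous_on UNIV F" by (simp add: continuous_on_eq_continuous_at)
  obtain \<Phi> where "\<And>t. (\<Phi> has_vector_derivative F t) (at t)"
    using einterval_antiderivative[of "-\<infinity>" "\<infinity>" F] \<open>\<And>t. isCont F t\<close> by auto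
  then have \<Phi>: "(\<Phi> has_real_derivative F t) (at t)" for t
    by (simp add: has_real_derivative_iff_has_vector_derivative)
  have shift: "((\<lambda>r. f (r + c)) has_real_derivative D) (at t)"
    if "(f has_real_derivative D) (at (t + c))" for f :: "real \<Rightarrow> real" and c D t
    using that by (simp only: DERIV_shift)
  define \<phi> where "\<phi> s = (\<integral>y. k (circle_of (coord y - s)) \<partial>\<nu>)" for s
  have *: "\<bar>\<phi> s - \<phi> t\<bar> \<le> K * (t - s)" if st: "s \<le> t" for s t
  proof -
    define G where "G r = F (r - s) - F (r - t)" for r
    define g' where "g' y = k (circle_of (coord y - s)) - k (circle_of (coord y - t))" for y
    have G1: "G (r + 1) = G r" for r
      using F1[of "r - s"] F1[of "r - t"] by (simp add: G_def algebra_simps)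
    have C1: "circle_C1 (\<lambda>x. G (coord x)) g'"
    proof (rule circle_C1_of_periodic[of G, OF G1])
      show "continuous_on UNIV g'"
        unfolding g'_def by (intro continuous_intros continuous_rotate k)
      show "(G has_real_derivative g' (circle_of r)) (at r)" for r
        using DERIV_diff[OF shift[of F _ r "-s", OF F] shift[of F _ r "-t", OF F]]
        by (simp add: G_def[abs_def] g'_def circle_of_coord_diff)
    qed
    have G0: "0 \<le> G r" for r
    proof -
      have "F (r - t) \<le> F (r - s)"
        by (rule DERIV_nonneg_imp_nondecreasing) (use st F k(2) in auto)
      then show ?thesis by (simp add: G_def)
    qed
    have cG: "continuous_on UNIV G"
      unfolding G_def by (intro continuous_intros continuous_on_compose2[OF cF]) auto
    have "(\<integral>x. \<bar>G (coord x)\<bar> \<partial>circle_lebesgue) = (\<integral>r. G r \<partial>lborel_on 0 1)"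
      using G0 circle_C1_continuous[OF C1]
      by (subst integral_circle_lebesgue)
         (auto intro!: borel_measurable_continuous_onI continuous_on_rabs simp: periodic_coord[of G, OF G1])
    also have "\<dots> = (\<Phi> (1 - s) - \<Phi> (1 - t)) - (\<Phi> (0 - s) - \<Phi> (0 - t))"
    proof (rule integral_interval_FTC[where F = "\<lambda>r. \<Phi> (r - s) - \<Phi> (r - t)"])
      show "((\<lambda>r. \<Phi> (r - s) - \<Phi> (r - t)) has_real_derivative G r) (at r)" for r
        using DERIV_diff[OF shift[of \<Phi> _ r "-s", OF \<Phi>] shift[of \<Phi> _ r "-t", OF \<Phi>]]
        by (simp add: G_def[abs_def])
    qed (use cG in simp_all)
    also have "\<dots> = t - s"
    proof -
      have "((\<lambda>r. \<Phi> (r + 1) - \<Phi> r - r) has_real_derivative 0) (at r)" for r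
        using DERIV_diff[OF DERIV_diff[OF shift[of \<Phi> _ r 1, OF \<Phi>] \<Phi>[of r]] DERIV_ident] by (simp add: F1)
      then have "\<Phi> (-s + 1) - \<Phi> (-s) - (-s) = \<Phi> (-t + 1) - \<Phi> (-t) - (-t)"
        using DERIV_isconst_all[of "\<lambda>r. \<Phi> (r + 1) - \<Phi> r - r" "-s" "-t"] by blast
      then show ?thesis by simp
    qed
    finally have "\<bar>\<integral>x. g' x \<partial>\<nu>\<bar> \<le> K * (t - s)"
      using K[OF C1] by simp
    moreover have "(\<integral>x. g' x \<partial>\<nu>) = \<phi> s - \<phi> t"
      unfolding g'_def \<phi>_def
      by (intro Bochner_Integration.integral_diff integrable_continuous_circle[OF \<nu>] continuous_rotate k)
    ultimately show ?thesis by simp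
  qed
  have **: "\<bar>\<phi> s - \<phi> t\<bar> \<le> K * \<bar>s - t\<bar>" for s t
    using *[of s t] *[of t s] by (cases "s \<le> t") (auto simp: abs_minus_commute)
  have per: "\<phi> (coord (circle_of t)) = \<phi> t" for t
    by (simp add: \<phi>_def circle_of_diff_coord)
  have "\<phi> (coord z + circle_diff x z) = \<phi> (coord x)"
    using per[of "coord z + circle_diff x z"] by (simp add: circle_of_add_circle_diff)
  then show ?thesis
    using **[of "coord z + circle_diff x z" "coord z"]
    by (simp add: mollify_def \<phi>_def dist_circle_eq_circle_diff)
qed

text \<open>By Fubini, mollifying \<open>\<nu>\<close> amounts to replacing \<open>f\<close> by weighted averages over balls of radius \<open>d\<close>.\<close>

lemma mollify_approx:
  assumes k: "continuous_on UNIV k" "\<And>x. 0 \<le> k x" "(\<integral>x. k x \<partial>circle_lebesgue) = 1"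
    "\<And>x. d \<le> dist x (circle_of 0) \<Longrightarrow> k x = 0"
    and \<nu>: "prob_space \<nu>" "sets \<nu> = sets borel"
    and f: "continuous_on UNIV f" "\<And>x y. dist x y < d \<Longrightarrow> \<bar>f x - f y\<bar> \<le> e"
  shows "\<bar>(\<integral>x. f x * mollify k \<nu> x \<partial>circle_lebesgue) - (\<integral>x. f x \<partial>\<nu>)\<bar> \<le> e"
proof -
  interpret N: prob_space \<nu> by (rule \<nu>)
  interpret M: prob_space circle_lebesgue by (rule prob_space_circle_lebesgue)
  interpret P: pair_prob_space circle_lebesgue \<nu> ..
  have [measurable]: "k \<in> borel_measurable borel" "f \<in> borel_measurable borel"
    by (intro borel_measurable_continuous_onI k f)+
  note [measurable_cong] = \<nu>(2)
  obtain F where F: "\<And>t. (F has_real_derivative k (circle_of t)) (at t)"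
    and F1: "\<And>t. F (t + 1) = F t + 1"
    using antiderivative_circle_lift[OF k(1)] k(3) by metis
  obtain Bk where Bk: "\<And>x. \<bar>k x\<bar> \<le> Bk" using bounded_continuous_circle[OF k(1)] by blast
  obtain Bf where Bf: "\<And>x. \<bar>f x\<bar> \<le> Bf" using bounded_continuous_circle[OF f(1)] by blast
  have B: "\<bar>f x * k y\<bar> \<le> Bf * Bk" for x y
    unfolding abs_mult using Bf Bk by (intro mult_mono order_trans[OF abs_ge_zero Bf]) auto
  define J where "J y = (\<integral>x. f x * k (circle_of (coord y - coord x)) \<partial>circle_lebesgue)" for y
  have int: "integrable (circle_lebesgue \<Otimes>\<^sub>M \<nu>) (\<lambda>(x, y). f x * k (circle_of (coord y - coord x)))"
    by (rule P.integrable_const_bound[of _ "Bf * Bk"]) (auto simp: B)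
  have "(\<integral>x. f x * mollify k \<nu> x \<partial>circle_lebesgue)
      = (\<integral>x. \<integral>y. f x * k (circle_of (coord y - coord x)) \<partial>\<nu> \<partial>circle_lebesgue)"
    by (simp add: mollify_def)
  also have "\<dots> = (\<integral>y. J y \<partial>\<nu>)"
    unfolding J_def using P.Fubini_integral[OF int] by simp
  finally have 1: "(\<integral>x. f x * mollify k \<nu> x \<partial>circle_lebesgue) = (\<integral>y. J y \<partial>\<nu>)" .
  have intJ: "integrable \<nu> J"
    unfolding J_def by (rule P.integrable_snd[OF int])
  have ck: "continuous_on UNIV (\<lambda>x. k (circle_of (s - coord x)))" for s
  proof (rule continuous_circleI)
    have "continuous_on UNIV (\<lambda>t. circle_of (s - t))"
      by (rule continuous_on_compose2[OF continuous_on_circle_of]) (auto intro!: continuous_intros)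
    then show "continuous_on UNIV (\<lambda>t. k (circle_of (s - coord (circle_of t))))"
      using continuous_on_compose2[OF k(1)] by (simp add: circle_of_diff_coord)
  qed
  have mass: "(\<integral>x. k (circle_of (s - coord x)) \<partial>circle_lebesgue) = 1" for s
  proof -
    have "continuous_on UNIV (\<lambda>t. k (circle_of (s - t)))"
      using continuous_on_compose2[OF ck[of s] continuous_on_circle_of] by (simp add: circle_of_diff_coord)
    moreover have "((\<lambda>t. - F (s - t)) has_real_derivative k (circle_of (s - t))) (at t)" for t
      using DERIV_minus[OF DERIV_chain2[OF F DERIV_diff[OF DERIV_const DERIV_ident]], of s t] by simp
    ultimately have "(\<integral>t. k (circle_of (s - t)) \<partial>lborel_on 0 1) = - F (s - 1) - - F (s - 0)"
      by (intro integral_interval_FTC) auto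
    then show ?thesis
      using F1[of "s - 1"] by (subst integral_circle_lebesgue)
        (auto intro!: borel_measurable_continuous_onI ck simp: circle_of_diff_coord)
  qed
  note intc = integrable_continuous_circle[OF prob_space_circle_lebesgue sets_circle_lebesgue]
  have Jf: "\<bar>J y - f y\<bar> \<le> e" for y
  proof -
    let ?k = "\<lambda>x. k (circle_of (coord y - coord x))"
    have "J y - f y = (\<integral>x. f x * ?k x \<partial>circle_lebesgue) - (\<integral>x. f y * ?k x \<partial>circle_lebesgue)"
      by (simp add: J_def mass)
    also have "\<dots> = (\<integral>x. f x * ?k x - f y * ?k x \<partial>circle_lebesgue)"
      by (rule Bochner_Integration.integral_diff[symmetric]) (intro intc continuous_intros f ck)+
    finally have "\<bar>J y - f y\<bar> \<le> (\<integral>x. \<bar>f x * ?k x - f y * ?k x\<bar> \<partial>circle_lebesgue)"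
      using integral_abs_bound by metis
    also have "\<dots> \<le> (\<integral>x. e * ?k x \<partial>circle_lebesgue)"
    proof (intro integral_mono)
      fix x
      have "dist (circle_of (coord y - coord x)) (circle_of 0) = dist (circle_of (coord y)) (circle_of (coord x))"
        unfolding dist_circle_eq_circle_diff circle_diff_circle_of by simp
      then have d: "dist (circle_of (coord y - coord x)) (circle_of 0) = dist x y"
        by (simp add: circle_of_coord dist_commute)
      have "\<bar>f x * ?k x - f y * ?k x\<bar> = \<bar>f x - f y\<bar> * ?k x"
        using k(2) by (simp add: left_diff_distrib[symmetric] abs_mult)
      also have "\<dots> \<le> e * ?k x"
        using f(2)[of x y] k(4)[of "circle_of (coord y - coord x)"] k(2)
        by (cases "dist x y < d") (auto simp: d intro: mult_right_mono)
      finally show "\<bar>f x * ?k x - f y * ?k x\<bar> \<le> e * ?k x" .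
    qed (intro intc continuous_intros f ck)+
    also have "\<dots> = e" by (simp add: mass)
    finally show ?thesis .
  qed
  have intf: "integrable \<nu> f" by (rule integrable_continuous_circle[OF \<nu> f(1)])
  have "(\<integral>y. J y \<partial>\<nu>) - (\<integral>x. f x \<partial>\<nu>) = (\<integral>y. J y - f y \<partial>\<nu>)"
    by (simp add: intJ intf)
  then have "\<bar>(\<integral>y. J y \<partial>\<nu>) - (\<integral>x. f x \<partial>\<nu>)\<bar> \<le> (\<integral>y. \<bar>J y - f y\<bar> \<partial>\<nu>)"
    using integral_abs_bound by metis
  also have "\<dots> \<le> (\<integral>y. e \<partial>\<nu>)"
    using Jf intJ intf by (intro integral_mono) auto
  finally show ?thesis by (simp add: 1 N.prob_space)
qed



section \<open>A stationary Lipschitz density\<close>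

text \<open>The indicator of a nonempty closed set is the decreasing limit of the continuous functions
  \<open>max 0 (1 - n infdist x C)\<close>.\<close>

lemma prob_measures_eqI_continuous:
  fixes M N :: "circle measure"
  assumes M: "prob_space M" "sets M = sets borel" and N: "prob_space N" "sets N = sets borel"
    and eq: "\<And>f. continuous_on UNIV f \<Longrightarrow> (\<integral>x. f x \<partial>M) = (\<integral>x. f x \<partial>N :: real)"
  shows "M = N"
proof (rule measure_eqI_generator_eq[where E = "Collect closed" and \<Omega> = UNIV and A = "\<lambda>_. UNIV"])
  show "Int_stable (Collect closed :: circle set set)"
    by (auto simp: Int_stable_def)
  show "sets M = sigma_sets UNIV (Collect closed)" "sets N = sigma_sets UNIV (Collect closed)"
    using M N by (simp_all add: borel_eq_closed)
  interpret M: prob_space M by (rule M)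
  interpret N: prob_space N by (rule N)
  show "emeasure M UNIV \<noteq> \<infinity>" by simp
  fix C :: "circle set" assume "C \<in> Collect closed"
  then have C: "closed C" by simp
  have Cb: "C \<in> sets borel" using C by simp
  show "emeasure M C = emeasure N C"
  proof (cases "C = {}")
    case False
    define f where "f n x = max 0 (1 - real n * infdist x C)" for n x
    have cf: "continuous_on UNIV (f n)" for n
      unfolding f_def by (intro continuous_intros)
    have lim: "(\<lambda>n. f n x) \<longlonglongrightarrow> indicator C x" for x
    proof (cases "x \<in> C")
      case True
      then show ?thesis by (simp add: f_def)
    next
      case x: False
      have "0 < infdist x C"
        using C False x infdist_nonneg[of x C] in_closed_iff_infdist_zero[of C x] by simp
      then obtain n0 where n0: "1 < real n0 * infdist x C" using reals_Archimedean3 by blast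
      have "f n x = 0" if "n0 \<le> n" for n
      proof -
        have "real n0 * infdist x C \<le> real n * infdist x C"
          using that by (intro mult_right_mono) (auto simp: infdist_nonneg)
        with n0 show ?thesis by (simp add: f_def)
      qed
      then have "eventually (\<lambda>n. f n x = 0) sequentially"
        unfolding eventually_sequentially by blast
      then show ?thesis using x by (simp add: tendsto_eventually)
    qed
    have meas: "(\<lambda>n. \<integral>x. f n x \<partial>L) \<longlonglongrightarrow> measure L C"
      if L: "prob_space L" "sets L = sets borel" for L
    proof -
      interpret L: prob_space L by (rule L)
      have fL: "f n \<in> borel_measurable L" for n
        using borel_measurable_continuous_onI[OF cf] by (simp add: measurable_cong_sets[OF L(2) refl])
      have "(\<lambda>n. \<integral>x. f n x \<partial>L) \<longlonglongrightarrow> (\<integral>x. indicator C x \<partial>L)"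
      proof (rule integral_dominated_convergence[where w = "\<lambda>_. 1"])
        show "AE x in L. norm (f n x) \<le> 1" for n
          by (simp add: f_def infdist_nonneg)
        show "AE x in L. (\<lambda>n. f n x) \<longlonglongrightarrow> indicator C x"
          by (intro AE_I2 lim)
      qed (use fL Cb L(2) in simp_all)
      then show ?thesis using Cb L(2) sets_eq_imp_space_eq[OF L(2)] by simp
    qed
    have "measure M C = measure N C"
      using LIMSEQ_unique[OF meas[OF M] meas[OF N, folded eq[OF cf]]] .
    then show ?thesis by (simp add: M.emeasure_eq_measure N.emeasure_eq_measure)
  qed simp
qed auto

context random_circle_maps
begin

lemma continuous_markov_op:
  assumes f: "continuous_on UNIV f"
  shows "continuous_on UNIV (Q f)"
  unfolding continuous_on_sequentially
proof (intro ballI allI impI)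
  fix X :: "nat \<Rightarrow> circle" and x
  assume "x \<in> UNIV" and "(\<forall>n. X n \<in> UNIV) \<and> X \<longlonglongrightarrow> x"
  then have X: "X \<longlonglongrightarrow> x" by simp
  obtain B where B: "\<And>x. \<bar>f x\<bar> \<le> B" using bounded_continuous_circle[OF f] by blast
  have [measurable]: "f \<in> borel_measurable borel" by (rule borel_measurable_continuous_onI[OF f])
  have "(\<lambda>n. \<integral>w. f (T w (X n)) \<partial>\<eta>) \<longlonglongrightarrow> (\<integral>w. f (T w x) \<partial>\<eta>)"
  proof (rule integral_dominated_convergence[where w = "\<lambda>_. B"])
    have "(\<lambda>n. f (T w (X n))) \<longlonglongrightarrow> f (T w x)" if w: "w \<in> space \<eta>" for w
      using continuous_on_tendsto_compose[OF continuous_on_compose2[OF f continuous_T[OF w]] X] by simp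
    then show "AE w in \<eta>. (\<lambda>n. f (T w (X n))) \<longlonglongrightarrow> f (T w x)" by (intro AE_I2)
  qed (auto simp: B)
  then show "(Q f \<circ> X) \<longlonglongrightarrow> Q f x"
    by (simp add: markov_op_def o_def)
qed

text \<open>Only continuous functions are tested, since they are the ones that survive the passage to a limit of
  distributions.\<close>

definition stationary_density :: "(circle \<Rightarrow> real) \<Rightarrow> bool" where
  "stationary_density \<phi> \<longleftrightarrow>
     continuous_on UNIV \<phi> \<and> (\<forall>x. 0 \<le> \<phi> x) \<and> (\<integral>x. \<phi> x \<partial>circle_lebesgue) = 1 \<and>
     (\<forall>f. continuous_on UNIV f \<longrightarrow>
        (\<integral>x. Q f x * \<phi> x \<partial>circle_lebesgue) = (\<integral>x. f x * \<phi> x \<partial>circle_lebesgue))"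

lemma stationary_densityD:
  assumes "stationary_density \<phi>"
  shows "continuous_on UNIV \<phi>" "0 \<le> \<phi> x" "(\<integral>x. \<phi> x \<partial>circle_lebesgue) = 1"
    "continuous_on UNIV f \<Longrightarrow>
      (\<integral>x. Q f x * \<phi> x \<partial>circle_lebesgue) = (\<integral>x. f x * \<phi> x \<partial>circle_lebesgue)"
  using assms by (auto simp: stationary_density_def)

text \<open>The measure with density \<open>\<phi>\<close> and its image under one step of the chain agree on continuous functions,
  hence coincide, which gives stationarity against every bounded measurable function.\<close>

lemma stationary_of_density:
  assumes "stationary_density \<phi>"
  shows "stationary \<eta> T (density circle_lebesgue (\<lambda>x. ennreal (\<phi> x)))"
proof -
  note \<phi> = stationary_densityD(1-3)[OF assms] and inv = stationary_densityD(4)[OF assms]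
  let ?\<mu> = "density circle_lebesgue (\<lambda>x. ennreal (\<phi> x))"
  have m\<phi>[measurable]: "\<phi> \<in> borel_measurable borel" by (rule borel_measurable_continuous_onI[OF \<phi>(1)])
  have sets: "sets ?\<mu> = sets borel" by simp
  have int\<phi>: "integrable circle_lebesgue \<phi>"
    by (rule integrable_continuous_circle[OF prob_space_circle_lebesgue sets_circle_lebesgue \<phi>(1)])
  have p: "prob_space ?\<mu>"
  proof (rule prob_spaceI)
    have "emeasure ?\<mu> (space ?\<mu>) = (\<integral>\<^sup>+x. ennreal (\<phi> x) \<partial>circle_lebesgue)"
      by (simp add: emeasure_density)
    also have "\<dots> = 1" using nn_integral_eq_integral[OF int\<phi>] \<phi>(2,3) by simp
    finally show "emeasure ?\<mu> (space ?\<mu>) = 1" .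
  qed
  have dens: "(\<integral>x. f x \<partial>?\<mu>) = (\<integral>x. f x * \<phi> x \<partial>circle_lebesgue)"
    if "continuous_on UNIV f" for f :: "circle \<Rightarrow> real"
    using integral_density[of f circle_lebesgue \<phi>] borel_measurable_continuous_onI[OF that] \<phi>(2)
    by (simp add: mult.commute)
  have "push ?\<mu> = ?\<mu>"
  proof (rule prob_measures_eqI_continuous[OF prob_space_push[OF p sets] sets_push p sets])
    fix f :: "circle \<Rightarrow> real" assume f: "continuous_on UNIV f"
    obtain B where B: "\<And>x. \<bar>f x\<bar> \<le> B" using bounded_continuous_circle[OF f] by blast
    have "(\<integral>x. f x \<partial>push ?\<mu>) = (\<integral>x. Q f x \<partial>?\<mu>)"
      by (rule integral_push[OF p sets borel_measurable_continuous_onI[OF f] B])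
    also have "\<dots> = (\<integral>x. f x \<partial>?\<mu>)"
      by (simp only: dens[OF f] dens[OF continuous_markov_op[OF f]] inv[OF f])
    finally show "(\<integral>x. f x \<partial>push ?\<mu>) = (\<integral>x. f x \<partial>?\<mu>)" .
  qed
  then have "(\<integral>x. Q f x \<partial>?\<mu>) = (\<integral>x. f x \<partial>?\<mu>)"
    if f: "f \<in> borel_measurable borel" "bounded (range f)" for f
  proof -
    obtain B where "\<And>x. \<bar>f x\<bar> \<le> B" using f(2) by (auto simp: bounded_iff)
    from integral_push[OF p sets f(1) this] show ?thesis
      by (simp only: \<open>push ?\<mu> = ?\<mu>\<close>)
  qed
  then show ?thesis unfolding stationary_def using p sets by (intro conjI ballI impI)
qed

end

lemma dist_circle_le_1: "dist (x :: circle) y \<le> 1"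
  using coord_ge_0[of x] coord_less_1[of x] coord_ge_0[of y] coord_less_1[of y]
  by (simp add: dist_circle_def)

context expanding_on_average
begin

text \<open>The time averages of the distributions of the chain started from Lebesgue measure, mollified at a scale
  tending to \<open>0\<close>, have densities \<open>\<Phi> n\<close> that are equi-Lipschitz and uniformly bounded, so
  a subsequence converges uniformly.  Mollification does not affect the limits of integrals of continuous functions,
  and the averages are asymptotically invariant, so the limit is a stationary density.\<close>

lemma exists_stationary_lipschitz_density:
  "\<exists>\<phi> K. stationary_density \<phi> \<and> K-lipschitz_on UNIV \<phi>"
proof -
  interpret M: prob_space circle_lebesgue by (rule prob_space_circle_lebesgue)
  note intc = integrable_continuous_circle[OF prob_space_circle_lebesgue sets_circle_lebesgue]
  obtain K where K0: "0 \<le> K" and K: "\<And>n g g'. circle_C1 g g' \<Longrightarrow>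
       \<bar>\<integral>x. (Q ^^ n) g' x \<partial>circle_lebesgue\<bar> \<le> K * (\<integral>x. \<bar>g x\<bar> \<partial>circle_lebesgue)"
    by (rule markov_op_power_deriv_bound) (rule that; blast)
  define P where "P n = (push ^^ n) circle_lebesgue" for n
  have P: "prob_space (P n)" "sets (P n) = sets borel" for n
    using push_power by (auto simp: P_def)
  have PK: "\<bar>\<integral>x. g' x \<partial>P n\<bar> \<le> K * (\<integral>x. \<bar>g x\<bar> \<partial>circle_lebesgue)" if g: "circle_C1 g g'" for n g g'
  proof -
    have cg': "continuous_on UNIV g'" by (rule circle_C1_D[OF g])
    obtain B where B: "\<And>x. \<bar>g' x\<bar> \<le> B" using bounded_continuous_circle[OF cg'] by blast
    show ?thesis
      unfolding P_def integral_push_power[OF borel_measurable_continuous_onI[OF cg'] B] by (rule K[OF g])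
  qed
  have "\<forall>n. \<exists>k :: circle \<Rightarrow> real. continuous_on UNIV k \<and> (\<forall>x. 0 \<le> k x) \<and> (\<integral>x. k x \<partial>circle_lebesgue) = 1
    \<and> (\<forall>x. inverse (real (Suc n)) \<le> dist x (circle_of 0) \<longrightarrow> k x = 0)"
  proof
    fix n
    show "\<exists>k :: circle \<Rightarrow> real. continuous_on UNIV k \<and> (\<forall>x. 0 \<le> k x) \<and> (\<integral>x. k x \<partial>circle_lebesgue) = 1
      \<and> (\<forall>x. inverse (real (Suc n)) \<le> dist x (circle_of 0) \<longrightarrow> k x = 0)"
      by (rule exists_kernel[of "inverse (real (Suc n))"]) auto
  qed
  then obtain k :: "nat \<Rightarrow> circle \<Rightarrow> real"
    where "\<forall>n. continuous_on UNIV (k n) \<and> (\<forall>x. 0 \<le> k n x) \<and> (\<integral>x. k n x \<partial>circle_lebesgue) = 1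
      \<and> (\<forall>x. inverse (real (Suc n)) \<le> dist x (circle_of 0) \<longrightarrow> k n x = 0)"
    by (rule choice[THEN exE])
  then have k: "continuous_on UNIV (k n)" "0 \<le> k n x" "(\<integral>x. k n x \<partial>circle_lebesgue) = 1"
    "inverse (real (Suc n)) \<le> dist x (circle_of 0) \<Longrightarrow> k n x = 0" for n x
    by auto
  define \<Phi> where "\<Phi> n x = (\<Sum>i<Suc n. mollify (k n) (P i) x) / real (Suc n)" for n x
  define A where "A n f = (\<Sum>i<Suc n. \<integral>x. f x \<partial>P i) / real (Suc n)" for n and f :: "circle \<Rightarrow> real"
  have mlip: "\<bar>mollify (k n) (P i) x - mollify (k n) (P i) z\<bar> \<le> K * dist x z" for n i x z
    by (rule mollify_lipschitz[OF k(1-3) P PK])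
  have average: "\<bar>(\<Sum>i<Suc n. a i) / real (Suc n)\<bar> \<le> c" if "\<And>i. \<bar>a i\<bar> \<le> c" for n c and a :: "nat \<Rightarrow> real"
  proof -
    have "\<bar>\<Sum>i<Suc n. a i\<bar> \<le> (\<Sum>i<Suc n. c)"
      by (rule order_trans[OF sum_abs sum_mono]) (rule that)
    then show ?thesis by (simp add: divide_le_eq abs_divide mult.commute)
  qed
  have \<Phi>lip: "\<bar>\<Phi> n x - \<Phi> n z\<bar> \<le> K * dist x z" for n x z
    using average[of "\<lambda>i. mollify (k n) (P i) x - mollify (k n) (P i) z" "K * dist x z" n] mlip
    by (simp add: \<Phi>_def sum_subtractf diff_divide_distrib[symmetric])
  have mcont: "continuous_on UNIV (mollify (k n) (P i))" for n i
    by (rule lipschitz_on_continuous_on[of K]) (use mlip K0 in \<open>auto simp: lipschitz_on_def dist_real_def\<close>)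
  have \<Phi>cont: "continuous_on UNIV (\<Phi> n)" for n
    unfolding \<Phi>_def by (intro continuous_intros mcont) simp
  have \<Phi>0: "0 \<le> \<Phi> n x" for n x
    unfolding \<Phi>_def by (intro divide_nonneg_nonneg sum_nonneg of_nat_0_le_iff) (simp add: mollify_def k(2))
  have \<Phi>int: "(\<integral>x. f x * \<Phi> n x \<partial>circle_lebesgue)
      = (\<Sum>i<Suc n. \<integral>x. f x * mollify (k n) (P i) x \<partial>circle_lebesgue) / real (Suc n)"
    if f: "continuous_on UNIV f" for f n
  proof -
    have "(\<integral>x. f x * \<Phi> n x \<partial>circle_lebesgue)
        = (\<integral>x. (\<Sum>i<Suc n. f x * mollify (k n) (P i) x) / real (Suc n) \<partial>circle_lebesgue)"
      by (simp only: \<Phi>_def sum_distrib_left times_divide_eq_right)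
    also have "\<dots> = (\<integral>x. (\<Sum>i<Suc n. f x * mollify (k n) (P i) x) \<partial>circle_lebesgue) / real (Suc n)"
      by (rule integral_divide_zero)
    also have "(\<integral>x. (\<Sum>i<Suc n. f x * mollify (k n) (P i) x) \<partial>circle_lebesgue)
        = (\<Sum>i<Suc n. \<integral>x. f x * mollify (k n) (P i) x \<partial>circle_lebesgue)"
      by (intro Bochner_Integration.integral_sum intc continuous_intros f mcont)
    finally show ?thesis .
  qed
  have approx: "\<bar>(\<integral>x. f x * \<Phi> n x \<partial>circle_lebesgue) - A n f\<bar> \<le> e"
    if f: "continuous_on UNIV f" and e: "\<And>x y. dist x y < inverse (real (Suc n)) \<Longrightarrow> \<bar>f x - f y\<bar> \<le> e" for f n e
    using average[of "\<lambda>i. (\<integral>x. f x * mollify (k n) (P i) x \<partial>circle_lebesgue) - (\<integral>x. f x \<partial>P i)" e n]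
      mollify_approx[OF k P f e]
    by (simp add: \<Phi>int[OF f] A_def sum_subtractf diff_divide_distrib[symmetric])
  have mass: "(\<integral>x. \<Phi> n x \<partial>circle_lebesgue) = 1" for n
  proof -
    have "A n (\<lambda>_. 1) = 1"
      using prob_space.prob_space[OF P(1)] by (simp add: A_def)
    then show ?thesis using approx[of "\<lambda>_. 1" n 0] by simp
  qed
  have \<Phi>le: "\<Phi> n x \<le> 1 + K" for n x
  proof -
    have "\<Phi> n x = (\<integral>y. \<Phi> n x \<partial>circle_lebesgue)" using M.prob_space by simp
    also have "\<dots> \<le> (\<integral>y. \<Phi> n y + K \<partial>circle_lebesgue)"
    proof (rule integral_mono)
      fix y
      have "\<bar>\<Phi> n x - \<Phi> n y\<bar> \<le> K * 1"
        by (rule order_trans[OF \<Phi>lip mult_left_mono[OF dist_circle_le_1 K0]])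
      then show "\<Phi> n x \<le> \<Phi> n y + K" by linarith
    qed (intro intc continuous_intros \<Phi>cont)+
    also have "\<dots> = 1 + K"
      using M.prob_space mass by (subst Bochner_Integration.integral_add) (auto intro: intc \<Phi>cont)
    finally show ?thesis .
  qed
  have Alim: "(\<lambda>n. (\<integral>x. f x * \<Phi> n x \<partial>circle_lebesgue) - A n f) \<longlonglongrightarrow> 0" if f: "continuous_on UNIV f" for f
  proof (rule LIMSEQ_I)
    fix r :: real assume r: "0 < r"
    have "uniformly_continuous_on UNIV f"
      by (rule compact_uniformly_continuous[OF f compact_circle])
    then obtain d where d: "0 < d" "\<And>x y. dist x y < d \<Longrightarrow> dist (f x) (f y) < r / 2"
      unfolding uniformly_continuous_on_def using r by (metis UNIV_I half_gt_zero)
    obtain N where N: "inverse (real (Suc N)) < d" using reals_Archimedean[OF d(1)] by blast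
    have "\<bar>(\<integral>x. f x * \<Phi> n x \<partial>circle_lebesgue) - A n f\<bar> \<le> r / 2" if n: "N \<le> n" for n
    proof (rule approx[OF f])
      fix x y :: circle assume "dist x y < inverse (real (Suc n))"
      also have "\<dots> \<le> inverse (real (Suc N))" using n by simp
      finally show "\<bar>f x - f y\<bar> \<le> r / 2" using d(2)[of x y] N by (simp add: dist_real_def)
    qed
    then show "\<exists>no. \<forall>n\<ge>no. norm ((\<integral>x. f x * \<Phi> n x \<partial>circle_lebesgue) - A n f - 0) < r"
      using r by (intro exI[of _ N]) fastforce
  qed
  \<comment> \<open>telescoping leaves only the two end terms of the time average\<close>
  have Ainv: "(\<lambda>n. A n (Q f) - A n f) \<longlonglongrightarrow> 0" if f: "continuous_on UNIV f" for f
  proof -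
    obtain B where B: "\<And>x. \<bar>f x\<bar> \<le> B" using bounded_continuous_circle[OF f] by blast
    have bd: "\<bar>\<integral>x. f x \<partial>P i\<bar> \<le> B" for i
    proof -
      interpret Pi: prob_space "P i" by (rule P)
      have "\<bar>\<integral>x. f x \<partial>P i\<bar> \<le> (\<integral>x. \<bar>f x\<bar> \<partial>P i)" by (rule integral_abs_bound)
      also have "\<dots> \<le> (\<integral>x. B \<partial>P i)"
        by (intro integral_mono integrable_continuous_circle[OF P] continuous_intros f B)
      finally show ?thesis by (simp add: Pi.prob_space)
    qed
    have eq: "A n (Q f) - A n f = ((\<integral>x. f x \<partial>P (Suc n)) - (\<integral>x. f x \<partial>P 0)) / real (Suc n)" for n
    proof -
      have "(\<integral>x. Q f x \<partial>P i) = (\<integral>x. f x \<partial>P (Suc i))" for i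
        using integral_push[OF P borel_measurable_continuous_onI[OF f] B] by (simp add: P_def)
      then have "A n (Q f) - A n f = (\<Sum>i<Suc n. (\<integral>x. f x \<partial>P (Suc i)) - (\<integral>x. f x \<partial>P i)) / real (Suc n)"
        by (simp only: A_def sum_subtractf diff_divide_distrib)
      also have "(\<Sum>i<Suc n. (\<integral>x. f x \<partial>P (Suc i)) - (\<integral>x. f x \<partial>P i)) = (\<integral>x. f x \<partial>P (Suc n)) - (\<integral>x. f x \<partial>P 0)"
        by (rule sum_lessThan_telescope)
      finally show ?thesis .
    qed
    have bd2: "\<bar>(\<integral>x. f x \<partial>P (Suc n)) - (\<integral>x. f x \<partial>P 0)\<bar> \<le> 2 * B" for n
      using bd[of "Suc n"] bd[of 0] by linarith
    have le: "norm (A n (Q f) - A n f) \<le> 2 * B * inverse (real (Suc n))" for n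
      unfolding eq real_norm_def abs_divide abs_of_nat
      using divide_right_mono[OF bd2[of n], of "real (Suc n)"] by (simp only: divide_inverse of_nat_0_le_iff)
    have "(\<lambda>n. 2 * B * inverse (real (Suc n))) \<longlonglongrightarrow> 0"
      by (rule tendsto_mult_right_zero[OF LIMSEQ_inverse_real_of_nat])
    then show ?thesis
      by (rule Lim_null_comparison[OF always_eventually[OF allI[OF le]]])
  qed
  obtain g r where r: "strict_mono (r :: nat \<Rightarrow> nat)"
    and g: "\<And>e. 0 < e \<Longrightarrow> \<exists>N. \<forall>n x. n \<ge> N \<and> x \<in> {0..1::real} \<longrightarrow> norm (\<Phi> (r n) (circle_of x) - g x) < e"
  proof (rule Arzela_Ascoli[of "{0..1::real}" "\<lambda>n t. \<Phi> n (circle_of t)" "1 + K"])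
    show "norm (\<Phi> n (circle_of x)) \<le> 1 + K" for n x using \<Phi>0 \<Phi>le by simp
    show "\<exists>d. 0 < d \<and> (\<forall>n y. y \<in> {0..1} \<and> norm (x - y) < d \<longrightarrow>
        norm (\<Phi> n (circle_of x) - \<Phi> n (circle_of y)) < e)" if e: "0 < e" for x e :: real
    proof (intro exI[of _ "e / (K + 1)"] conjI allI impI)
      show "0 < e / (K + 1)" using e K0 by simp
      fix n y assume "y \<in> {0..1} \<and> norm (x - y) < e / (K + 1)"
      then have y: "\<bar>x - y\<bar> * (K + 1) < e" using K0 by (simp add: less_divide_eq)
      have "\<bar>\<Phi> n (circle_of x) - \<Phi> n (circle_of y)\<bar> \<le> K * dist (circle_of x) (circle_of y)"
        by (rule \<Phi>lip)
      also have "\<dots> \<le> K * \<bar>x - y\<bar>"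
        using dist_circle_of_le[of x y] K0 by (intro mult_left_mono) (auto simp: dist_real_def)
      also have "\<dots> \<le> \<bar>x - y\<bar> * (K + 1)" by (simp add: algebra_simps)
      finally show "norm (\<Phi> n (circle_of x) - \<Phi> n (circle_of y)) < e" using y by simp
    qed
    fix g k
    assume "strict_mono (k :: nat \<Rightarrow> nat)"
      "\<And>e. 0 < e \<Longrightarrow> \<exists>N. \<forall>n x. n \<ge> N \<and> x \<in> {0..1::real} \<longrightarrow> norm (\<Phi> (k n) (circle_of x) - g x) < e"
    then show thesis by (rule that)
  qed simp
  define \<phi> where "\<phi> x = g (coord x)" for x
  have lim: "(\<lambda>n. \<Phi> (r n) x) \<longlonglongrightarrow> \<phi> x" for x
  proof (rule LIMSEQ_I)
    fix e :: real assume "0 < e"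
    then obtain N where "\<And>n y. n \<ge> N \<Longrightarrow> y \<in> {0..1} \<Longrightarrow> norm (\<Phi> (r n) (circle_of y) - g y) < e"
      using g by blast
    from this[of _ "coord x"] show "\<exists>no. \<forall>n\<ge>no. norm (\<Phi> (r n) x - \<phi> x) < e"
      using coord_ge_0[of x] coord_less_1[of x] by (auto simp: \<phi>_def circle_of_coord)
  qed
  have lip: "\<bar>\<phi> x - \<phi> y\<bar> \<le> K * dist x y" for x y
    by (rule LIMSEQ_le_const2[OF tendsto_rabs[OF tendsto_diff[OF lim lim]]]) (use \<Phi>lip in auto)
  have \<phi>0: "0 \<le> \<phi> x" for x
    by (rule LIMSEQ_le_const[OF lim]) (use \<Phi>0 in auto)
  have lipschitz: "K-lipschitz_on UNIV \<phi>"
    using lip K0 by (auto simp: lipschitz_on_def dist_real_def)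
  then have c\<phi>: "continuous_on UNIV \<phi>" by (rule lipschitz_on_continuous_on)
  have ilim: "(\<lambda>n. \<integral>x. f x * \<Phi> (r n) x \<partial>circle_lebesgue) \<longlonglongrightarrow> (\<integral>x. f x * \<phi> x \<partial>circle_lebesgue)"
    if f: "continuous_on UNIV f" for f
  proof -
    obtain B where B: "\<And>x. \<bar>f x\<bar> \<le> B" using bounded_continuous_circle[OF f] by blast
    show ?thesis
    proof (rule integral_dominated_convergence[where w = "\<lambda>_. B * (1 + K)"])
      show "(\<lambda>x. f x * \<phi> x) \<in> borel_measurable circle_lebesgue"
        by (rule borel_measurable_integrable) (intro intc continuous_intros f c\<phi>)
      show "(\<lambda>x. f x * \<Phi> (r n) x) \<in> borel_measurable circle_lebesgue" for n
        by (rule borel_measurable_integrable) (intro intc continuous_intros f \<Phi>cont)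
      show "AE x in circle_lebesgue. (\<lambda>n. f x * \<Phi> (r n) x) \<longlonglongrightarrow> f x * \<phi> x"
        by (intro AE_I2 tendsto_intros lim)
      show "AE x in circle_lebesgue. norm (f x * \<Phi> (r n) x) \<le> B * (1 + K)" for n
        using \<Phi>0 \<Phi>le order_trans[OF abs_ge_zero B] B
        by (intro AE_I2) (auto simp: abs_mult intro!: mult_mono)
    qed simp
  qed
  have "(\<integral>x. \<phi> x \<partial>circle_lebesgue) = 1"
    using LIMSEQ_unique[OF ilim[of "\<lambda>_. 1"]] mass by simp
  moreover have "(\<integral>x. Q f x * \<phi> x \<partial>circle_lebesgue) = (\<integral>x. f x * \<phi> x \<partial>circle_lebesgue)"
    if f: "continuous_on UNIV f" for f
  proof -
    have lim: "(\<lambda>n. A (r n) h) \<longlonglongrightarrow> (\<integral>x. h x * \<phi> x \<partial>circle_lebesgue)" if h: "continuous_on UNIV h" for h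
      using tendsto_diff[OF ilim[OF h] LIMSEQ_subseq_LIMSEQ[OF Alim[OF h] r]] by (simp add: o_def)
    have "(\<lambda>n. A (r n) (Q f) - A (r n) f) \<longlonglongrightarrow> 0"
      using LIMSEQ_subseq_LIMSEQ[OF Ainv[OF f] r] by (simp add: o_def)
    from LIMSEQ_unique[OF this tendsto_diff[OF lim[OF continuous_markov_op[OF f]] lim[OF f]]]
    show ?thesis by simp
  qed
  ultimately have "stationary_density \<phi>"
    using c\<phi> \<phi>0 by (simp add: stationary_density_def)
  with lipschitz show ?thesis by blast
qed

end



section \<open>Positivity\<close>

text \<open>The velocity of a path is again described through test functions, so that composing the path with a map
  of the circle is just the composition of the test function with that map.\<close>

definition path_velocity :: "(real \<Rightarrow> circle) \<Rightarrow> (real \<Rightarrow> real) \<Rightarrow> bool" where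
  "path_velocity \<gamma> v \<longleftrightarrow> continuous_on UNIV \<gamma> \<and> continuous_on UNIV v \<and>
     (\<forall>g g'. circle_C1 g g' \<longrightarrow>
        (\<forall>t. ((\<lambda>s. g (\<gamma> s)) has_real_derivative g' (\<gamma> t) * v t) (at t)))"

lemma path_velocity_circle_of: "path_velocity circle_of (\<lambda>_. 1)"
  by (simp add: path_velocity_def continuous_on_circle_of circle_C1_D)

lemma path_velocity_image:
  assumes \<gamma>: "path_velocity \<gamma> v" and T: "C2_circle_map T"
  shows "path_velocity (\<lambda>t. T (\<gamma> t)) (\<lambda>t. circle_deriv T (\<gamma> t) * v t)"
proof -
  have c: "continuous_on UNIV \<gamma>" "continuous_on UNIV v"
    and d: "\<And>g g' t. circle_C1 g g' \<Longrightarrow> ((\<lambda>s. g (\<gamma> s)) has_real_derivative g' (\<gamma> t) * v t) (at t)"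
    using \<gamma> by (auto simp: path_velocity_def)
  have "continuous_on UNIV (\<lambda>t. T (\<gamma> t))"
    by (rule continuous_on_compose2[OF C2_circle_map_continuous[OF T] c(1)]) simp
  moreover have "continuous_on UNIV (\<lambda>t. circle_deriv T (\<gamma> t))"
    by (rule continuous_on_compose2[OF circle_C1_continuous[OF C2_circle_map_deriv_C1[OF T]] c(1)]) simp
  ultimately show ?thesis
    using d[OF circle_C1_compose[OF T]] by (auto simp: path_velocity_def mult.assoc intro!: continuous_intros c)
qed

text \<open>The derivative is continuous and the circle is connected.\<close>

lemma circle_deriv_sign:
  assumes T: "C2_circle_map T" and nz: "\<And>x. circle_deriv T x \<noteq> 0"
  obtains s :: real where "s = 1 \<or> s = -1" "\<And>x. s * circle_deriv T x = \<bar>circle_deriv T x\<bar>"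
proof -
  have "connected (range (circle_deriv T))"
    by (rule connected_continuous_image[OF circle_C1_continuous[OF C2_circle_map_deriv_C1[OF T]] connected_circle])
  then have iv: "z \<in> range (circle_deriv T)"
    if "circle_deriv T x \<le> z" "z \<le> circle_deriv T y" for x y z
    using that unfolding connected_iff_interval by blast
  have "(\<forall>x. 0 < circle_deriv T x) \<or> (\<forall>x. circle_deriv T x < 0)"
  proof (rule ccontr)
    assume "\<not> ?thesis"
    then obtain x y where "circle_deriv T x \<le> 0" "0 \<le> circle_deriv T y" by (auto simp: not_less)
    then have "0 \<in> range (circle_deriv T)" by (rule iv)
    then show False using nz by (metis imageE)
  qed
  then show ?thesis
  proof
    assume "\<forall>x. 0 < circle_deriv T x"
    then show ?thesis by (intro that[of 1]) (simp_all add: abs_of_pos)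
  next
    assume "\<forall>x. circle_deriv T x < 0"
    then show ?thesis by (intro that[of "-1"]) (auto simp: abs_of_neg)
  qed
qed

text \<open>A path whose velocity has a constant sign and modulus at least \<open>l\<close>, with \<open>(q - p) l \<ge> 3\<close>, covers the
  circle, so that a nonnegative \<open>u\<close> is integrated along it to at least its mean \<open>m\<close>, up to the maximal speed \<open>M\<close>.  The
  covering shows in integrated form: with \<open>g' = u - m\<close> and \<open>\<bar>g\<bar> \<le> m\<close>, the integral of \<open>(u - m) \<circ> \<gamma>\<close> times the velocity
  telescopes to a difference of values of \<open>g\<close>, which costs at most \<open>2 m\<close> of the \<open>3 m\<close> available.\<close>

lemma integral_along_fast_path:
  assumes \<gamma>: "path_velocity \<gamma> v" and sgn: "s = 1 \<or> s = -1"
    and v: "\<And>t. l \<le> s * v t" "\<And>t. s * v t \<le> M"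
    and pq: "p \<le> q" "3 \<le> (q - p) * l"
    and u: "continuous_on UNIV u" "\<And>x. 0 \<le> u x"
  shows "(\<integral>x. u x \<partial>circle_lebesgue) \<le> M * (\<integral>t. u (\<gamma> t) \<partial>lborel_on p q)"
proof -
  define m where "m = (\<integral>x. u x \<partial>circle_lebesgue)"
  have m0: "0 \<le> m" unfolding m_def by (simp add: u)
  obtain g where g: "circle_C1 g (\<lambda>x. u x - m)" and bd: "\<And>x. \<bar>g x\<bar> \<le> m"
    using circle_C1_antiderivative[OF u] unfolding m_def by blast
  have c: "continuous_on UNIV \<gamma>" "continuous_on UNIV v"
    and d: "\<And>t. ((\<lambda>s. g (\<gamma> s)) has_real_derivative (u (\<gamma> t) - m) * v t) (at t)"
    using \<gamma> g by (auto simp: path_velocity_def)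
  have cu: "continuous_on UNIV (\<lambda>t. u (\<gamma> t))"
    using continuous_on_compose2[OF u(1) c(1)] by simp
  note int = integrable_continuous_interval
  have "(\<integral>t. (u (\<gamma> t) - m) * v t \<partial>lborel_on p q) = g (\<gamma> q) - g (\<gamma> p)"
    by (rule integral_interval_FTC[OF pq(1) d]) (intro continuous_intros cu c)
  then have 1: "(\<integral>t. s * ((u (\<gamma> t) - m) * v t) \<partial>lborel_on p q) = s * (g (\<gamma> q) - g (\<gamma> p))"
    by (simp only: integral_mult_right_zero)
  have "m \<le> m * ((q - p) * l) - 2 * m"
    using mult_left_mono[OF pq(2) m0] by simp
  also have "\<dots> \<le> m * ((q - p) * l) + s * (g (\<gamma> q) - g (\<gamma> p))"
    using sgn bd[of "\<gamma> q"] bd[of "\<gamma> p"] by auto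
  also have "\<dots> \<le> (\<integral>t. m * (s * v t) \<partial>lborel_on p q) + (\<integral>t. s * ((u (\<gamma> t) - m) * v t) \<partial>lborel_on p q)"
  proof -
    have "(\<integral>t. l \<partial>lborel_on p q) \<le> (\<integral>t. s * v t \<partial>lborel_on p q)"
      by (intro integral_mono int continuous_intros c v)
    then have "(q - p) * l \<le> (\<integral>t. s * v t \<partial>lborel_on p q)"
      by (simp only: lebesgue_integral_const measure_interval[OF pq(1)] real_scaleR_def)
    then have "m * ((q - p) * l) \<le> (\<integral>t. m * (s * v t) \<partial>lborel_on p q)"
      unfolding integral_mult_right_zero by (rule mult_left_mono) (rule m0)
    then show ?thesis unfolding 1 by (rule add_right_mono)
  qed
  also have "\<dots> = (\<integral>t. m * (s * v t) + s * ((u (\<gamma> t) - m) * v t) \<partial>lborel_on p q)"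
    by (rule Bochner_Integration.integral_add[symmetric]) (intro int continuous_intros c cu)+
  also have "\<dots> = (\<integral>t. u (\<gamma> t) * (s * v t) \<partial>lborel_on p q)"
    by (intro Bochner_Integration.integral_cong refl) (simp add: algebra_simps)
  also have "\<dots> \<le> (\<integral>t. u (\<gamma> t) * M \<partial>lborel_on p q)"
    by (intro integral_mono int continuous_intros c cu mult_left_mono v u)
  finally show ?thesis by (simp add: m_def mult.commute)
qed

context random_circle_maps
begin

text \<open>If each of \<open>n\<close> successive maps falls into the event \<open>A\<close>, then the path is accelerated by \<open>s\<close> at each
  step, and its speed grows at most by the factor \<open>R\<close>.  The induction absorbs the first map into the path, so the
  hypothesis on \<open>l\<close> involves the number of steps still to come.\<close>

lemma markov_op_power_along_fast_path:
  assumes A[measurable]: "A \<in> sets \<eta>"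
    and lb: "\<And>w x. w \<in> A \<Longrightarrow> s \<le> \<bar>circle_deriv (T w) x\<bar>"
    and ub: "\<And>w x. w \<in> A \<Longrightarrow> \<bar>circle_deriv (T w) x\<bar> \<le> R"
    and sR: "0 < s" "0 < R" and pq: "p \<le> q"
    and u: "continuous_on UNIV u" "\<And>x. 0 \<le> u x"
  shows "path_velocity \<gamma> v \<Longrightarrow> \<sigma> = 1 \<or> \<sigma> = -1 \<Longrightarrow> (\<And>t. l \<le> \<sigma> * v t) \<Longrightarrow> (\<And>t. \<sigma> * v t \<le> M) \<Longrightarrow>
    0 < l \<Longrightarrow> 0 < M \<Longrightarrow> 3 \<le> (q - p) * (l * s ^ n) \<Longrightarrow>
    prob A ^ n * (\<integral>x. u x \<partial>circle_lebesgue) \<le> M * R ^ n * (\<integral>t. (Q ^^ n) u (\<gamma> t) \<partial>lborel_on p q)"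
proof (induction n arbitrary: \<gamma> v \<sigma> l M)
  case 0
  then show ?case
    using integral_along_fast_path[of \<gamma> v \<sigma> l M p q u] pq u by simp
next
  case (Suc n)
  let ?m = "\<integral>x. u x \<partial>circle_lebesgue"
  obtain B where B: "\<And>x. \<bar>u x\<bar> \<le> B" using bounded_continuous_circle[OF u(1)] by blast
  note Qn = markov_op_power[of u B n, OF borel_measurable_continuous_onI[OF u(1)] B]
  have Qn0: "0 \<le> (Q ^^ n) u x" for x
  proof (induction n arbitrary: x)
    case (Suc n)
    then show ?case by (simp add: markov_op_def[of _ _ "(Q ^^ n) u"])
  qed (simp add: u)
  have c\<gamma>: "continuous_on UNIV \<gamma>" using Suc.prems(1) by (simp add: path_velocity_def)
  have m\<gamma>: "\<gamma> \<in> lborel_on p q \<rightarrow>\<^sub>M borel"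
    by (rule measurable_restrict_space1) (simp add: borel_measurable_continuous_onI[OF c\<gamma>])
  note swap = integral_markov_op_swap[OF finite_measure_interval m\<gamma> Qn]
  define C where "C = prob A ^ n * ?m / (M * R * R ^ n)"
  have step: "indicator A w * C \<le> (\<integral>t. (Q ^^ n) u (T w (\<gamma> t)) \<partial>lborel_on p q)"
    if w: "w \<in> space \<eta>" for w
  proof (cases "w \<in> A")
    case True
    obtain \<tau> :: real where \<tau>: "\<tau> = 1 \<or> \<tau> = -1" "\<And>x. \<tau> * circle_deriv (T w) x = \<bar>circle_deriv (T w) x\<bar>"
      using circle_deriv_sign[OF C2[OF w] deriv_nonzero[OF w]] by blast
    have eq: "(\<sigma> * \<tau>) * (circle_deriv (T w) (\<gamma> t) * v t) = \<bar>circle_deriv (T w) (\<gamma> t)\<bar> * (\<sigma> * v t)" for t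
      unfolding \<tau>(2)[symmetric] by simp
    have "prob A ^ n * ?m \<le> (M * R) * R ^ n * (\<integral>t. (Q ^^ n) u (T w (\<gamma> t)) \<partial>lborel_on p q)"
    proof (rule Suc.IH[OF path_velocity_image[OF Suc.prems(1) C2[OF w]], of "\<sigma> * \<tau>" "l * s"])
      show "\<sigma> * \<tau> = 1 \<or> \<sigma> * \<tau> = -1" using Suc.prems(2) \<tau>(1) by auto
      show "l * s \<le> \<sigma> * \<tau> * (circle_deriv (T w) (\<gamma> t) * v t)" for t
        unfolding eq using mult_mono[OF lb[OF True, of "\<gamma> t"] Suc.prems(3)[of t]] Suc.prems(5) sR
        by (simp add: mult.commute)
      show "\<sigma> * \<tau> * (circle_deriv (T w) (\<gamma> t) * v t) \<le> M * R" for t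
        unfolding eq using mult_mono[OF ub[OF True, of "\<gamma> t"] Suc.prems(4)[of t]]
          order_trans[OF less_imp_le[OF Suc.prems(5)] Suc.prems(3)[of t]] sR
        by (simp add: mult.commute)
    qed (use Suc.prems(5-7) sR in \<open>auto simp: mult_ac\<close>)
    moreover have "0 < M * R * R ^ n" using Suc.prems(6) sR by simp
    ultimately show ?thesis
      using True by (simp add: C_def pos_divide_le_eq mult.commute)
  qed (simp add: Qn0)
  have "prob A * C = (\<integral>w. indicator A w * C \<partial>\<eta>)"
    by simp
  also have "\<dots> \<le> (\<integral>w. \<integral>t. (Q ^^ n) u (T w (\<gamma> t)) \<partial>lborel_on p q \<partial>\<eta>)"
    by (intro integral_mono swap(2) step integrable_mult_left integrable_real_indicator) (auto simp: less_top[symmetric])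
  also have "\<dots> = (\<integral>t. (Q ^^ Suc n) u (\<gamma> t) \<partial>lborel_on p q)"
    by (simp only: swap(1) funpow.simps o_apply)
  finally have "prob A * C \<le> (\<integral>t. (Q ^^ Suc n) u (\<gamma> t) \<partial>lborel_on p q)" .
  moreover have pos: "0 < M * R ^ Suc n" using Suc.prems(6) sR by simp
  ultimately have "(M * R ^ Suc n) * (prob A * C) \<le> (M * R ^ Suc n) * (\<integral>t. (Q ^^ Suc n) u (\<gamma> t) \<partial>lborel_on p q)"
    by (intro mult_left_mono) auto
  moreover have "(M * R ^ Suc n) * (prob A * C) = prob A ^ Suc n * ?m"
    using Suc.prems(6) sR by (simp add: C_def)
  ultimately show ?case by (simp only:)
qed

end

context expanding_on_average
begin

text \<open>If almost every map had minimal expansion at most \<open>1\<close>, the mean of \<open>1 / \<lambda>\<^sup>2\<close> would be at least \<open>1\<close>.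
  The event that the expansion exceeds \<open>1\<close> is exhausted by the countably many events \<open>E j\<close>, one of which has
  therefore positive probability.\<close>

lemma expanding_event:
  "\<exists>A\<in>sets \<eta>. \<exists>s>1. \<exists>R>0. 0 < prob A \<and>
     (\<forall>w\<in>A. \<forall>x. s \<le> \<bar>circle_deriv (T w) x\<bar> \<and> \<bar>circle_deriv (T w) x\<bar> \<le> R)"
proof -
  define E where "E j = {w \<in> space \<eta>. 1 + inverse (real (Suc j)) \<le> min_expansion (T w)
    \<and> (\<forall>x. \<bar>circle_deriv (T w) x\<bar> \<le> real (Suc j))}" for j
  have E[measurable]: "E j \<in> sets \<eta>" for j
    unfolding E_def by measurable
  have "\<exists>j. prob (E j) \<noteq> 0"
  proof (rule ccontr)
    assume "\<not> ?thesis"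
    then have "E j \<in> null_sets \<eta>" for j
      using E by (auto intro!: null_setsI simp: emeasure_eq_measure)
    then have "AE w in \<eta>. \<forall>j. w \<notin> E j"
      by (auto simp: AE_all_countable intro: AE_not_in)
    moreover have "(1 :: ennreal) \<le> ennreal (1 / (min_expansion (T w))\<^sup>2)"
      if w: "w \<in> space \<eta>" and notE: "\<forall>j. w \<notin> E j" for w
    proof -
      have "min_expansion (T w) \<le> 1"
      proof (rule ccontr)
        assume "\<not> min_expansion (T w) \<le> 1"
        then have "0 < min_expansion (T w) - 1" by simp
        then obtain i where i: "inverse (real (Suc i)) < min_expansion (T w) - 1"
          using reals_Archimedean by blast
        obtain B where B: "\<And>x. \<bar>circle_deriv (T w) x\<bar> \<le> B"
          using bounded_continuous_circle[OF continuous_deriv[OF w]] by blast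
        obtain k where k: "B < real k" using reals_Archimedean2 by blast
        let ?j = "max i k"
        have "inverse (real (Suc ?j)) \<le> inverse (real (Suc i))" by simp
        with i have "1 + inverse (real (Suc ?j)) \<le> min_expansion (T w)" by linarith
        moreover have "\<bar>circle_deriv (T w) x\<bar> \<le> real (Suc ?j)" for x
          using B[of x] k by linarith
        ultimately have "w \<in> E ?j" using w unfolding E_def by blast
        then show False using notE by blast
      qed
      moreover have "0 < min_expansion (T w)"
        by (rule min_expansion_pos[OF C2[OF w] deriv_nonzero[OF w]])
      ultimately have "(min_expansion (T w))\<^sup>2 \<le> 1" "0 < (min_expansion (T w))\<^sup>2"
        by (auto simp: power_le_one)
      then have "1 \<le> 1 / (min_expansion (T w))\<^sup>2" by simp
      then show ?thesis using ennreal_leI by fastforce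
    qed
    ultimately have "AE w in \<eta>. (1 :: ennreal) \<le> ennreal (1 / (min_expansion (T w))\<^sup>2)"
      by (auto elim: AE_mp)
    then have "(\<integral>\<^sup>+ w. 1 \<partial>\<eta>) \<le> (\<integral>\<^sup>+ w. ennreal (1 / (min_expansion (T w))\<^sup>2) \<partial>\<eta>)"
      by (rule nn_integral_mono_AE)
    with expansion show False by (simp add: emeasure_space_1)
  qed
  then obtain j where j: "prob (E j) \<noteq> 0" by blast
  have "0 < prob (E j)" using j by (simp add: zero_less_measure_iff)
  moreover have "1 + inverse (real (Suc j)) \<le> \<bar>circle_deriv (T w) x\<bar>"
      "\<bar>circle_deriv (T w) x\<bar> \<le> real (Suc j)" if "w \<in> E j" for w x
    using that min_expansion_le[of "T w" x] unfolding E_def by (auto intro: order_trans)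
  moreover have "1 < 1 + inverse (real (Suc j))" "0 < real (Suc j)" by simp_all
  ultimately show ?thesis using E by blast
qed

text \<open>The density exceeds some \<open>c > 0\<close> on an arc.  With positive probability \<open>n\<close> maps in a row are
  uniformly expanding, and for large \<open>n\<close> they spread the arc over the whole circle.  Stationarity over
  \<open>n\<close> steps then bounds the stationary measure below by a multiple \<open>\<delta>\<close> of Lebesgue measure.\<close>

lemma stationary_density_bounded_below:
  assumes "stationary_density \<phi>"
  shows "\<exists>\<delta>>0. \<forall>x. \<delta> \<le> \<phi> x"
proof -
  note \<phi> = stationary_densityD(1-3)[OF assms] and inv = stationary_densityD(4)[OF assms]
  note intc = integrable_continuous_circle[OF prob_space_circle_lebesgue sets_circle_lebesgue]
  have cQ: "continuous_on UNIV ((Q ^^ n) f)" if "continuous_on UNIV f" for f n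
    by (induction n) (simp_all add: that continuous_markov_op)
  have invn: "(\<integral>x. (Q ^^ n) f x * \<phi> x \<partial>circle_lebesgue) = (\<integral>x. f x * \<phi> x \<partial>circle_lebesgue)"
    if f: "continuous_on UNIV f" for f n
    by (induction n) (simp_all add: inv cQ[OF f])
  have "\<exists>x. \<phi> x \<noteq> 0"
  proof (rule ccontr)
    assume "\<not> ?thesis"
    then have "\<phi> = (\<lambda>_. 0)" by auto
    with \<phi>(3) show False by simp
  qed
  then obtain x0 where x0: "0 < \<phi> x0" using \<phi>(2) by (metis less_eq_real_def)
  define c where "c = \<phi> x0 / 2"
  have c: "0 < c" using x0 by (simp add: c_def)
  define p where "p = coord x0"
  have p: "0 \<le> p" "p < 1" using coord_ge_0 coord_less_1 by (auto simp: p_def)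
  have "continuous_on UNIV (\<lambda>t. \<phi> (circle_of t))"
    using continuous_on_compose2[OF \<phi>(1) continuous_on_circle_of] by simp
  then have "isCont (\<lambda>t. \<phi> (circle_of t)) p" by (simp add: continuous_on_eq_continuous_at)
  then obtain d where d: "0 < d" "\<And>t. dist t p < d \<Longrightarrow> dist (\<phi> (circle_of t)) (\<phi> (circle_of p)) < c"
    unfolding continuous_at_eps_delta using c by metis
  define q where "q = min 1 (p + d / 2)"
  have q: "p < q" "q \<le> 1" using p d(1) by (auto simp: q_def)
  have arc: "c \<le> \<phi> (circle_of t)" if "t \<in> {p..q}" for t
  proof -
    have "dist t p < d" using that d(1) by (auto simp: q_def dist_real_def)
    from d(2)[OF this] have "\<bar>\<phi> (circle_of t) - 2 * c\<bar> < c"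
      by (simp add: c_def p_def circle_of_coord dist_real_def)
    then show ?thesis by linarith
  qed
  obtain A s R where A: "A \<in> sets \<eta>" "0 < prob A" and sR: "1 < s" "0 < R"
    and lb: "\<And>w x. w \<in> A \<Longrightarrow> s \<le> \<bar>circle_deriv (T w) x\<bar>"
    and ub: "\<And>w x. w \<in> A \<Longrightarrow> \<bar>circle_deriv (T w) x\<bar> \<le> R"
    using expanding_event by blast
  obtain n where n0: "3 / (q - p) < s ^ n" using real_arch_pow[OF sR(1), of "3 / (q - p)"] by auto
  have n: "3 \<le> (q - p) * (1 * s ^ n)"
    using less_imp_le[OF n0] q(1) by (simp add: pos_divide_le_eq mult.commute)
  define \<delta> where "\<delta> = c * (prob A ^ n / R ^ n)"
  have \<delta>: "0 < \<delta>" using c A(2) sR by (simp add: \<delta>_def)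
  have key: "\<delta> * (\<integral>x. u x \<partial>circle_lebesgue) \<le> (\<integral>x. u x * \<phi> x \<partial>circle_lebesgue)"
    if u: "continuous_on UNIV u" "\<And>x. 0 \<le> u x" for u
  proof -
    let ?f = "\<lambda>t. (Q ^^ n) u (circle_of t)"
    have Q0: "0 \<le> (Q ^^ k) u x" for k x
    proof (induction k arbitrary: x)
      case (Suc k)
      then show ?case by (simp add: markov_op_def[of _ _ "(Q ^^ k) u"])
    qed (simp add: u)
    have cf: "continuous_on UNIV ?f"
      using continuous_on_compose2[OF cQ[OF u(1)] continuous_on_circle_of] by simp
    have c\<phi>: "continuous_on UNIV (\<lambda>t. \<phi> (circle_of t))"
      using continuous_on_compose2[OF \<phi>(1) continuous_on_circle_of] by simp
    have "prob A ^ n * (\<integral>x. u x \<partial>circle_lebesgue) \<le> 1 * R ^ n * (\<integral>t. ?f t \<partial>lborel_on p q)"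
      by (rule markov_op_power_along_fast_path[OF A(1) lb ub _ sR(2) _ u path_velocity_circle_of,
            where \<sigma> = 1 and l = 1])
         (use sR q n in auto)
    then have "prob A ^ n / R ^ n * (\<integral>x. u x \<partial>circle_lebesgue) \<le> (\<integral>t. ?f t \<partial>lborel_on p q)"
      using sR by (simp add: pos_divide_le_eq mult.commute)
    from mult_left_mono[OF this less_imp_le[OF c]]
    have "\<delta> * (\<integral>x. u x \<partial>circle_lebesgue) \<le> c * (\<integral>t. ?f t \<partial>lborel_on p q)"
      by (simp only: \<delta>_def mult.assoc)
    also have "\<dots> = (\<integral>t. c * ?f t \<partial>lborel_on p q)" by simp
    also have "\<dots> = (\<integral>t. indicator {p..q} t *\<^sub>R (c * ?f t) \<partial>lborel)"
      by (rule integral_restrict_space) simp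
    also have "\<dots> \<le> (\<integral>t. indicator {0..1} t *\<^sub>R (?f t * \<phi> (circle_of t)) \<partial>lborel)"
    proof (rule integral_mono)
      show "integrable lborel (\<lambda>t. indicator {p..q} t *\<^sub>R (c * ?f t))"
        by (rule integrable_restrict_space[THEN iffD1])
           (simp, intro integrable_continuous_interval continuous_intros cf)
      show "integrable lborel (\<lambda>t. indicator {0..1} t *\<^sub>R (?f t * \<phi> (circle_of t)))"
        by (rule integrable_restrict_space[THEN iffD1])
           (simp, intro integrable_continuous_interval continuous_intros cf c\<phi>)
      fix t :: real
      show "indicator {p..q} t *\<^sub>R (c * ?f t) \<le> indicator {0..1} t *\<^sub>R (?f t * \<phi> (circle_of t))"
      proof (cases "t \<in> {p..q}")
        case True
        then have "t \<in> {0..1}" using p q by auto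
        with True show ?thesis
          using mult_right_mono[OF arc[OF True] Q0[of n "circle_of t"]] by (simp add: mult.commute)
      next
        case False
        then show ?thesis by (simp add: Q0 \<phi>(2) indicator_simps(2)[OF False] del: atLeastAtMost_iff)
      qed
    qed
    also have "\<dots> = (\<integral>t. ?f t * \<phi> (circle_of t) \<partial>lborel_on 0 1)"
      by (rule integral_restrict_space[symmetric]) simp
    also have "\<dots> = (\<integral>x. (Q ^^ n) u x * \<phi> x \<partial>circle_lebesgue)"
      by (rule integral_circle_lebesgue[symmetric])
         (intro borel_measurable_continuous_onI continuous_intros cQ u \<phi>(1))
    also have "\<dots> = (\<integral>x. u x * \<phi> x \<partial>circle_lebesgue)" by (rule invn[OF u(1)])
    finally show ?thesis .
  qed
  have "\<delta> \<le> \<phi> x" for x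
  proof -
    \<comment> \<open>testing the bound on the amount by which \<open>\<phi>\<close> falls short of \<open>\<delta>\<close>\<close>
    define u where "u x = max 0 (\<delta> - \<phi> x)" for x
    have u: "continuous_on UNIV u" "\<And>x. 0 \<le> u x"
      unfolding u_def by (intro continuous_intros \<phi>(1)) simp
    have sq: "(u x)\<^sup>2 = \<delta> * u x - u x * \<phi> x" for x
      by (auto simp: u_def max_def power2_eq_square algebra_simps)
    have "(\<integral>x. (u x)\<^sup>2 \<partial>circle_lebesgue)
        = (\<integral>x. \<delta> * u x \<partial>circle_lebesgue) - (\<integral>x. u x * \<phi> x \<partial>circle_lebesgue)"
      unfolding sq by (rule Bochner_Integration.integral_diff) (intro intc continuous_intros u \<phi>(1))+
    then have "(\<integral>x. (u x)\<^sup>2 \<partial>circle_lebesgue) \<le> 0" using key[OF u] by simp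
    moreover have "0 \<le> (\<integral>x. (u x)\<^sup>2 \<partial>circle_lebesgue)" by simp
    ultimately have "(u x)\<^sup>2 = 0"
      by (intro integral_continuous_zero[of "\<lambda>x. (u x)\<^sup>2"] continuous_intros u) auto
    then show ?thesis by (simp add: u_def max_def split: if_splits)
  qed
  with \<delta> show ?thesis by blast
qed

end

theorem theorem1:
  fixes \<eta> :: "'w measure" and T :: "'w \<Rightarrow> circle \<Rightarrow> circle"
  assumes "prob_space \<eta>"
    and "\<And>w. w \<in> space \<eta> \<Longrightarrow> C2_circle_map (T w)"
    and "\<And>w x. w \<in> space \<eta> \<Longrightarrow> circle_deriv (T w) x \<noteq> 0"
    and "(\<lambda>(w, x). T w x) \<in> \<eta> \<Otimes>\<^sub>M borel \<rightarrow>\<^sub>M borel"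
    and "(\<integral>\<^sup>+ w. ennreal (1 / (min_expansion (T w))\<^sup>2) \<partial>\<eta>) < 1"
    and "(\<integral>\<^sup>+ w. ennreal ((distortion (T w))\<^sup>2) \<partial>\<eta>) < \<infinity>"
  shows "\<exists>(\<mu> :: circle measure) (\<phi> :: circle \<Rightarrow> real).
     stationary \<eta> T \<mu> \<and>
     absolutely_continuous circle_lebesgue \<mu> \<and>
     \<mu> = density circle_lebesgue (\<lambda>x. ennreal (\<phi> x)) \<and>
     (\<exists>L. L-lipschitz_on UNIV \<phi>) \<and>
     (\<exists>c>0. \<forall>x. c \<le> \<phi> x)"
proof -
  interpret expanding_on_average \<eta> T
    using assms unfolding expanding_on_average_def expanding_on_average_axioms_def
      random_circle_maps_def random_circle_maps_axioms_def by blast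
  obtain \<phi> K where \<phi>: "stationary_density \<phi>" and lip: "K-lipschitz_on UNIV \<phi>"
    using exists_stationary_lipschitz_density by blast
  have cont: "continuous_on UNIV \<phi>" by (rule stationary_densityD(1)[OF \<phi>])
  have "\<exists>\<delta>>0. \<forall>x. \<delta> \<le> \<phi> x" by (rule stationary_density_bounded_below[OF \<phi>])
  moreover have "stationary \<eta> T (density circle_lebesgue (\<lambda>x. ennreal (\<phi> x)))"
    by (rule stationary_of_density[OF \<phi>])
  moreover have "absolutely_continuous circle_lebesgue (density circle_lebesgue (\<lambda>x. ennreal (\<phi> x)))"
    using borel_measurable_continuous_onI[OF cont]
    by (intro absolutely_continuousI_density) simp
  ultimately show ?thesis using lip by blast
qed

end
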